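(* For every fixed area, the equilateral triangle is the unique (up to congruence) maximizer of $\rho_2$ among all triangles of that area.
   Context: For a bounded simply connected region $\Omega\subseteq\mathbb{C}$, let $\mathcal{P}_2$ be the space of complex polynomials in $z$ of degree at most $2$, and let $dA$ denote area measure. Define $$\rho_2(\Omega):=\min_{p\in\mathcal{P}_2}\int_\Omega|\bar z-p(z)|^2\,dA(z),$$ the square of the distance from $\bar z$ to $\mathcal{P}_2$ in $L^2(\Omega,dA)$. Triangles are regarded as regions in $\mathbb{C}\cong\mathbb{R}^2$; $\rho_2$ is invariant under congruence. *)

theory Defs
  imports "HOL-Analysis.Analysis" "HOL-Computational_Algebra.Polynomial"
begin

text \<open>
  The minimum over polynomials of degree at most 2 is written as an infimum;
  \<open>rho2_attained\<close> below shows that it is attained on bounded regions.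
\<close>

definition rho2 :: "complex set \<Rightarrow> real" where
  "rho2 S = (INF p\<in>{p :: complex poly. degree p \<le> 2}.
      (LINT z:S|lborel. (cmod (cnj z - poly p z))\<^sup>2))"

text \<open>Triangles are open regions: the interior of the hull of three non-collinear vertices.\<close>

definition triangle_with_vertices :: "complex \<Rightarrow> complex \<Rightarrow> complex \<Rightarrow> complex set \<Rightarrow> bool" where
  "triangle_with_vertices a b c T \<longleftrightarrow>
     \<not> collinear {a, b, c} \<and> T = interior (convex hull {a, b, c})"

definition is_triangle :: "complex set \<Rightarrow> bool" where
  "is_triangle T \<longleftrightarrow> (\<exists>a b c. triangle_with_vertices a b c T)"

definition is_equilateral :: "complex set \<Rightarrow> bool" where
  "is_equilateral T \<longleftrightarrow>
     (\<exists>a b c. triangle_with_vertices a b c T \<and> dist a b = dist b c \<and> dist b c = dist c a)"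

definition area :: "complex set \<Rightarrow> real" where
  "area S = measure lborel S"

text \<open>Distance-preserving maps of the plane are bijective; reflections are included.\<close>

definition congruent_sets :: "complex set \<Rightarrow> complex set \<Rightarrow> bool" where
  "congruent_sets S T \<longleftrightarrow>
     (\<exists>f :: complex \<Rightarrow> complex. (\<forall>x y. dist (f x) (f y) = dist x y) \<and> f ` S = T)"

context
  fixes S :: "complex set"
  assumes bS: "bounded S" and oS: "open S" and neS: "S \<noteq> {}"
begin

private definition quad :: "complex \<times> complex \<times> complex \<Rightarrow> complex \<Rightarrow> complex" where
  "quad v z = fst v + z * (fst (snd v) + z * snd (snd v))"

private lemma quad_poly: "poly [:a, b, c:] z = quad (a, b, c) z"
  by (simp add: quad_def)

private definition sq_dist :: "complex \<Rightarrow> complex \<times> complex \<times> complex \<Rightarrow> real" where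
  "sq_dist t v = (LINT z:S|lborel. (cmod (t * cnj z - quad v z))\<^sup>2)"

private lemma integrable_cont:
  fixes g :: "complex \<Rightarrow> real"
  assumes "continuous_on UNIV g"
  shows "set_integrable lborel S g"
proof -
  have "compact (closure S)" using bS by simp
  then have "set_integrable lborel (closure S) g"
    using borel_integrable_compact[of "closure S" g] continuous_on_subset[OF assms]
    by (simp add: set_integrable_def)
  then show ?thesis
    by (rule set_integrable_subset) (use oS closure_subset in auto)
qed

private lemma integrable_quad:
  "set_integrable lborel S (\<lambda>z. (cmod (t * cnj z - quad v z))\<^sup>2)"
  by (rule integrable_cont) (auto simp: quad_def intro!: continuous_intros)

private lemma sq_dist_cont: "isCont (sq_dist t) v"
proof -
  obtain R where R: "\<And>z. z \<in> S \<Longrightarrow> cmod z \<le> R" and R0: "R > 0"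
    using bS bounded_pos by metis
  show ?thesis
    unfolding continuous_at_sequentially
  proof (intro allI impI)
    fix w :: "nat \<Rightarrow> complex \<times> complex \<times> complex"
    assume w: "w \<longlonglongrightarrow> v"
    then obtain K where K: "\<And>n. norm (w n) \<le> K"
      by (metis BseqE convergentI convergent_imp_Bseq)
    then have K0: "K \<ge> 0" using norm_ge_zero order_trans by blast
    have bound: "cmod (t * cnj z - quad (w n) z) \<le> cmod t * R + (K + R * (K + R * K))"
      if "z \<in> S" for z n
    proof -
      have c: "cmod (fst (w n)) \<le> K" "cmod (fst (snd (w n))) \<le> K" "cmod (snd (snd (w n))) \<le> K"
        using K[of n] norm_fst_le[of "fst (w n)" "snd (w n)"] norm_snd_le[of "snd (w n)" "fst (w n)"]
          norm_fst_le[of "fst (snd (w n))" "snd (snd (w n))"] norm_snd_le[of "snd (snd (w n))" "fst (snd (w n))"]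
        unfolding prod.collapse by linarith+
      have "cmod (z * snd (snd (w n))) \<le> R * K"
        using R[OF that] c R0 by (auto simp: norm_mult intro!: mult_mono)
      then have "cmod (fst (snd (w n)) + z * snd (snd (w n))) \<le> K + R * K"
        using c by (intro norm_triangle_mono)
      then have "cmod (z * (fst (snd (w n)) + z * snd (snd (w n)))) \<le> R * (K + R * K)"
        using R[OF that] R0 by (auto simp: norm_mult intro!: mult_mono)
      then have "cmod (quad (w n) z) \<le> K + R * (K + R * K)"
        unfolding quad_def using c by (intro norm_triangle_mono)
      moreover have "cmod (t * cnj z) \<le> cmod t * R"
        using R[OF that] by (auto simp: norm_mult intro!: mult_left_mono)
      ultimately show ?thesis
        by (smt (verit) norm_triangle_ineq4)
    qed
    show "(sq_dist t \<circ> w) \<longlonglongrightarrow> sq_dist t v"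
      unfolding comp_def sq_dist_def set_lebesgue_integral_def
    proof (rule integral_dominated_convergence)
      show "integrable lborel (\<lambda>z. indicator S z *\<^sub>R (cmod t * R + (K + R * (K + R * K)))\<^sup>2)"
        using integrable_cont[of "\<lambda>z. (cmod t * R + (K + R * (K + R * K)))\<^sup>2"]
        by (simp add: set_integrable_def)
      show "AE z in lborel. (\<lambda>n. indicator S z *\<^sub>R (cmod (t * cnj z - quad (w n) z))\<^sup>2)
              \<longlonglongrightarrow> indicator S z *\<^sub>R (cmod (t * cnj z - quad v z))\<^sup>2"
        unfolding quad_def using w by (intro AE_I2 tendsto_intros)
      show "AE z in lborel. norm (indicator S z *\<^sub>R (cmod (t * cnj z - quad (w n) z))\<^sup>2)
              \<le> indicator S z *\<^sub>R (cmod t * R + (K + R * (K + R * K)))\<^sup>2" for n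
        using bound by (intro AE_I2) (auto simp: indicator_def intro!: power_mono)
    qed (use integrable_quad in \<open>auto simp: set_integrable_def\<close>)
  qed
qed

private lemma sq_dist_scale: "sq_dist 0 (r *\<^sub>R v) = r\<^sup>2 * sq_dist 0 v"
proof -
  have *: "quad (r *\<^sub>R v) z = r *\<^sub>R quad v z" for z
    by (simp add: quad_def algebra_simps)
  show ?thesis
    unfolding sq_dist_def by (simp add: * power_mult_distrib)
qed

private lemma sq_dist_pos:
  assumes "v \<noteq> 0"
  shows "sq_dist 0 v > 0"
proof (rule ccontr)
  assume "\<not> sq_dist 0 v > 0"
  moreover have "sq_dist 0 v \<ge> 0"
    unfolding sq_dist_def set_lebesgue_integral_def by (rule integral_nonneg_AE) simp
  ultimately have "sq_dist 0 v = 0" by simp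
  then have "AE z in lborel. indicator S z *\<^sub>R (cmod (0 * cnj z - quad v z))\<^sup>2 = 0"
    using integral_nonneg_eq_0_iff_AE[OF integrable_quad[of 0 v, unfolded set_integrable_def]]
    unfolding sq_dist_def set_lebesgue_integral_def by simp
  then have ae: "AE z in lborel. \<not> (z \<in> S \<and> quad v z \<noteq> 0)"
    by (rule AE_mp) (auto simp: indicator_def)
  obtain a b c where v: "v = (a, b, c)" by (cases v) auto
  have "finite {z. quad v z = 0}"
    using poly_roots_finite[of "[:a, b, c:]"] assms
    unfolding quad_poly v by (auto simp: zero_prod_def)
  then have "AE z in lborel. z \<notin> {z. quad v z = 0}"
    by (intro AE_not_in finite_imp_null_set_lborel)
  with ae have "AE z in lborel. z \<notin> S"
    by eventually_elim auto
  then have "emeasure lborel S = 0"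
    using oS by (subst (asm) AE_iff_measurable[of S]) auto
  then have "negligible S"
    using oS by (auto simp: negligible_iff_null_sets null_sets_def intro!: null_sets_completionI)
  then show False
    using open_not_negligible[OF oS neS] by simp
qed

private lemma sq_dist_coercive:
  obtains m where "m > 0" "\<And>v. m * (norm v)\<^sup>2 \<le> sq_dist 0 v"
proof -
  let ?U = "sphere (0 :: complex \<times> complex \<times> complex) 1"
  have "(1, 0) \<in> ?U" by simp
  then have ne: "?U \<noteq> {}" by blast
  have "continuous_on ?U (sq_dist 0)"
    using sq_dist_cont continuous_at_imp_continuous_on by blast
  then obtain u where u: "u \<in> ?U" "\<And>x. x \<in> ?U \<Longrightarrow> sq_dist 0 u \<le> sq_dist 0 x"
    using continuous_attains_inf[OF compact_sphere ne] by blast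
  show ?thesis
  proof
    show "sq_dist 0 u > 0" using u(1) by (intro sq_dist_pos) auto
    show "sq_dist 0 u * (norm v)\<^sup>2 \<le> sq_dist 0 v" for v
    proof (cases "v = 0")
      case True
      then show ?thesis using sq_dist_scale[of 0 v] by simp
    next
      case False
      then have "sq_dist 0 u \<le> sq_dist 0 (v /\<^sub>R norm v)" by (intro u(2)) simp
      then have "(norm v)\<^sup>2 * sq_dist 0 u \<le> (norm v)\<^sup>2 * sq_dist 0 (v /\<^sub>R norm v)"
        by (intro mult_left_mono) auto
      also have "\<dots> = sq_dist 0 v"
        using sq_dist_scale[of "norm v" "v /\<^sub>R norm v"] False by simp
      finally show ?thesis by (simp add: mult.commute)
    qed
  qed
qed

private lemma sq_dist_triangle: "sq_dist 0 v \<le> 2 * sq_dist 1 v + 2 * sq_dist 1 0"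
proof -
  have pw: "(cmod (0 * cnj z - quad v z))\<^sup>2
      \<le> 2 * (cmod (1 * cnj z - quad v z))\<^sup>2 + 2 * (cmod (1 * cnj z - quad 0 z))\<^sup>2" for z
  proof -
    have real_sq: "x\<^sup>2 \<le> 2 * y\<^sup>2 + 2 * w\<^sup>2" if "0 \<le> x" "x \<le> y + w" for x y w :: real
    proof -
      have "x\<^sup>2 \<le> (y + w)\<^sup>2" using that by (intro power_mono) auto
      also have "(y + w)\<^sup>2 = 2 * y\<^sup>2 + 2 * w\<^sup>2 - (y - w)\<^sup>2"
        by (simp add: power2_eq_square algebra_simps)
      finally show ?thesis using zero_le_power2[of "y - w"] by linarith
    qed
    have "quad v z = cnj z - (cnj z - quad v z)" by simp
    then have "cmod (quad v z) \<le> cmod (cnj z - quad v z) + cmod (cnj z)"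
      by (metis norm_triangle_ineq4 add.commute)
    then have "(cmod (quad v z))\<^sup>2 \<le> 2 * (cmod (cnj z - quad v z))\<^sup>2 + 2 * (cmod (cnj z))\<^sup>2"
      by (rule real_sq[OF norm_ge_zero])
    moreover have "quad 0 z = 0" by (simp add: quad_def)
    ultimately show ?thesis by (simp only: mult_1 mult_zero_left diff_0 diff_0_right norm_minus_cancel)
  qed
  have i: "set_integrable lborel S (\<lambda>z. 2 * (cmod (1 * cnj z - quad w z))\<^sup>2)" for w
    by (rule set_integrable_mult_right) (rule integrable_quad)
  have "sq_dist 0 v \<le> (LINT z:S|lborel. 2 * (cmod (1 * cnj z - quad v z))\<^sup>2
      + 2 * (cmod (1 * cnj z - quad 0 z))\<^sup>2)"
    unfolding sq_dist_def
    by (rule set_integral_mono[OF integrable_quad set_integral_add(1)[OF i i] pw])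
  also have "\<dots> = (LINT z:S|lborel. 2 * (cmod (1 * cnj z - quad v z))\<^sup>2)
      + (LINT z:S|lborel. 2 * (cmod (1 * cnj z - quad 0 z))\<^sup>2)"
    by (rule set_integral_add(2)[OF i i])
  also have "\<dots> = 2 * sq_dist 1 v + 2 * sq_dist 1 0"
    unfolding sq_dist_def by (intro arg_cong2[of _ _ _ _ "(+)"] set_integral_mult_right)
  finally show ?thesis .
qed

lemma rho2_attained:
  obtains p :: "complex poly" where "degree p \<le> 2"
    "rho2 S = (LINT z:S|lborel. (cmod (cnj z - poly p z))\<^sup>2)"
    "\<And>q. degree q \<le> 2 \<Longrightarrow> rho2 S \<le> (LINT z:S|lborel. (cmod (cnj z - poly q z))\<^sup>2)"
proof -
  obtain m where m: "m > 0" "\<And>v. m * (norm v)\<^sup>2 \<le> sq_dist 0 v"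
    by (rule sq_dist_coercive) blast
  define C where "C = 4 * sq_dist 1 0 / m"
  have "sq_dist 1 0 \<ge> 0"
    unfolding sq_dist_def set_lebesgue_integral_def by (rule integral_nonneg_AE) simp
  then have C0: "C \<ge> 0" using m by (simp add: C_def)
  have "continuous_on (cball 0 (sqrt C)) (sq_dist 1)"
    using sq_dist_cont continuous_at_imp_continuous_on by blast
  moreover have "cball (0 :: complex \<times> complex \<times> complex) (sqrt C) \<noteq> {}"
    using C0 by simp
  ultimately obtain u where u: "\<And>x. x \<in> cball 0 (sqrt C) \<Longrightarrow> sq_dist 1 u \<le> sq_dist 1 x"
    using continuous_attains_inf[OF compact_cball] by blast
  have min: "sq_dist 1 u \<le> sq_dist 1 v" for v
  proof (cases "v \<in> cball 0 (sqrt C)")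
    case False
    then have "sqrt C < norm v" by simp
    then have "C < (norm v)\<^sup>2"
      using C0 by (metis real_sqrt_less_iff real_sqrt_abs abs_norm_cancel)
    then have "4 * sq_dist 1 0 < m * (norm v)\<^sup>2"
      using m by (simp add: C_def field_simps)
    with m(2)[of v] sq_dist_triangle[of v] have "sq_dist 1 0 < sq_dist 1 v" by simp
    moreover have "sq_dist 1 u \<le> sq_dist 1 0" using C0 by (intro u) simp
    ultimately show ?thesis by simp
  qed (rule u)
  have eq: "(LINT z:S|lborel. (cmod (cnj z - poly q z))\<^sup>2)
      = sq_dist 1 (coeff q 0, coeff q 1, coeff q 2)" if "degree q \<le> 2" for q
  proof -
    have "q = [:coeff q 0, coeff q 1, coeff q 2:]"
      using that by (auto simp: poly_eq_iff coeff_pCons numeral_2_eq_2 coeff_eq_0 split: nat.split)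
    then have "poly q z = quad (coeff q 0, coeff q 1, coeff q 2) z" for z
      using quad_poly by metis
    then show ?thesis unfolding sq_dist_def by simp
  qed
  obtain a b c where abc: "u = (a, b, c)" by (cases u) auto
  let ?p = "[:a, b, c:]"
  have dp: "degree ?p \<le> 2" by (simp add: degree_pCons_le order_trans[OF degree_pCons_le])
  have up: "(LINT z:S|lborel. (cmod (cnj z - poly ?p z))\<^sup>2) = sq_dist 1 u"
    using eq[OF dp] by (simp add: abc numeral_2_eq_2)
  have "rho2 S = sq_dist 1 u"
    unfolding rho2_def
  proof (rule cInf_eq_minimum)
    show "sq_dist 1 u \<in> (\<lambda>p. LINT z:S|lborel. (cmod (cnj z - poly p z))\<^sup>2) ` {p. degree p \<le> 2}"
      using dp up by (intro image_eqI[of _ _ ?p]) auto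
  qed (use eq min in auto)
  then show ?thesis
    using that[OF dp] up eq min by simp
qed

end

end

theory Submission
  imports Defs
begin

text \<open>
  Writing the vertices as \<open>\<kappa> + \<alpha> \<omega>\<^sup>k + \<beta> \<omega>\<^bsup>-k\<^esup>\<close> with \<open>\<omega>\<close> a primitive cube root of unity
  exhibits every triangle, after exchanging two vertices if necessary, as the image of one fixed
  equilateral triangle under \<open>z \<mapsto> \<kappa> + \<alpha> z + \<beta> cnj z\<close> with \<open>\<bar>\<beta>\<bar> < \<bar>\<alpha>\<bar>\<close>. The area is proportional
  to \<open>J = \<bar>\<alpha>\<bar>\<^sup>2 - \<bar>\<beta>\<bar>\<^sup>2\<close>, and the triangle is equilateral iff \<open>\<beta> = 0\<close>. The moments of the fixed
  triangle of order at most four turn \<open>rho2\<close> into the minimum of an explicit quadratic form.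
  For \<open>\<beta> = 0\<close> completing the square shows that \<open>rho2\<close> is at least \<open>3/20 J\<close> times the area.
  For \<open>\<beta> \<noteq> 0\<close> a suitable test polynomial already has a strictly smaller value.
\<close>

subsection \<open>Affine changes of variables in the plane\<close>

text \<open>Both measures give every box the product of its side lengths, and boxes determine
  \<open>lborel\<close>. This opens integrals over the complex plane to Fubini.\<close>

lemma lborel_complex_eq_distr:
  "(lborel :: complex measure) = distr (lborel \<Otimes>\<^sub>M lborel) borel (\<lambda>(x, y). Complex x y)"
proof (rule lborel_eqI)
  fix l u :: complex
  assume lu: "\<And>b. b \<in> Basis \<Longrightarrow> l \<bullet> b \<le> u \<bullet> b"
  have le: "Re l \<le> Re u" "Im l \<le> Im u"
    using lu[of 1] lu[of \<i>] by (auto simp: Basis_complex_def)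
  have m [measurable]: "(\<lambda>(x, y). Complex x y) \<in> lborel \<Otimes>\<^sub>M lborel \<rightarrow>\<^sub>M borel"
    by (simp add: borel_measurable_complex_iff case_prod_beta)
  have "(\<lambda>(x, y). Complex x y) -` box l u \<inter> space (lborel \<Otimes>\<^sub>M lborel)
      = {Re l<..<Re u} \<times> {Im l<..<Im u}"
    by (auto simp: box_complex_eq space_pair_measure)
  then show "emeasure (distr (lborel \<Otimes>\<^sub>M lborel) borel (\<lambda>(x, y). Complex x y)) (box l u)
      = (\<Prod>b\<in>Basis. (u - l) \<bullet> b)"
    using le
    by (simp add: emeasure_distr lborel.emeasure_pair_measure_Times Basis_complex_def ennreal_mult)
qed simp

lemma measurable_Complex [measurable (raw)]:
  assumes "f \<in> borel_measurable M" "g \<in> borel_measurable M"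
  shows "(\<lambda>x. Complex (f x) (g x)) \<in> borel_measurable M"
  using assms by (simp add: borel_measurable_complex_iff)

lemma nn_integral_lborel_complex:
  fixes f :: "complex \<Rightarrow> ennreal"
  assumes [measurable]: "f \<in> borel_measurable borel"
  shows "(\<integral>\<^sup>+z. f z \<partial>lborel) = (\<integral>\<^sup>+x. \<integral>\<^sup>+y. f (Complex x y) \<partial>lborel \<partial>lborel)"
proof -
  have m [measurable]: "(\<lambda>(x, y). Complex x y) \<in> lborel \<Otimes>\<^sub>M lborel \<rightarrow>\<^sub>M borel"
    by (simp add: borel_measurable_complex_iff case_prod_beta)
  show ?thesis
    by (subst lborel_complex_eq_distr, subst nn_integral_distr[OF m], simp,
        subst lborel.nn_integral_fst[symmetric]) auto
qed

text \<open>Gaussian elimination turns the planar substitution into two one-dimensional ones: first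
  in the second coordinate with the first fixed, then, after swapping the order of integration, in
  the first.\<close>

lemma nn_integral_complex_affine_real:
  fixes f :: "complex \<Rightarrow> ennreal" and a b c d r t :: real
  assumes [measurable]: "f \<in> borel_measurable borel" and det: "a * d - b * c \<noteq> 0"
  shows "(\<integral>\<^sup>+z. f z \<partial>lborel) = ennreal \<bar>a * d - b * c\<bar> *
    (\<integral>\<^sup>+x. \<integral>\<^sup>+y. f (Complex (t + a * x + b * y) (r + c * x + d * y)) \<partial>lborel \<partial>lborel)"
proof -
  have *: "(\<integral>\<^sup>+z. f z \<partial>lborel) = ennreal \<bar>a * d - b * c\<bar> *
      (\<integral>\<^sup>+y. \<integral>\<^sup>+x. f (Complex (t + a * x + b * y) (r + c * x + d * y)) \<partial>lborel \<partial>lborel)"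
    if a: "a \<noteq> 0" and det: "a * d - b * c \<noteq> 0" for a b c d
  proof -
    \<comment> \<open>The second pivot: solving \<open>X = t + a * x + b * y\<close> for
      \<open>x\<close> makes the second coordinate affine in \<open>y\<close> with slope
      \<open>e\<close>, and \<open>a * e\<close> is the determinant.\<close>
    define e where "e = (a * d - b * c) / a"
    have e: "e \<noteq> 0" using a det by (simp add: e_def)
    have "(\<integral>\<^sup>+z. f z \<partial>lborel) = (\<integral>\<^sup>+X. \<integral>\<^sup>+Y. f (Complex X Y) \<partial>lborel \<partial>lborel)"
      by (rule nn_integral_lborel_complex) simp
    also have "\<dots> = (\<integral>\<^sup>+X. ennreal \<bar>e\<bar> *
        (\<integral>\<^sup>+y. f (Complex X ((r + c / a * (X - t)) + e * y)) \<partial>lborel) \<partial>lborel)"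
      by (intro nn_integral_cong nn_integral_real_affine e) measurable
    also have "\<dots> = ennreal \<bar>e\<bar> *
        (\<integral>\<^sup>+X. \<integral>\<^sup>+y. f (Complex X ((r + c / a * (X - t)) + e * y)) \<partial>lborel \<partial>lborel)"
      by (rule nn_integral_cmult) measurable
    also have "(\<integral>\<^sup>+X. \<integral>\<^sup>+y. f (Complex X ((r + c / a * (X - t)) + e * y)) \<partial>lborel \<partial>lborel) =
        (\<integral>\<^sup>+y. \<integral>\<^sup>+X. f (Complex X ((r + c / a * (X - t)) + e * y)) \<partial>lborel \<partial>lborel)"
      by (rule lborel_pair.Fubini'[symmetric]) measurable
    also have "\<dots> = (\<integral>\<^sup>+y. ennreal \<bar>a\<bar> * (\<integral>\<^sup>+x. f (Complex ((t + b * y) + a * x)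
        ((r + c / a * ((t + b * y) + a * x - t)) + e * y)) \<partial>lborel) \<partial>lborel)"
      by (intro nn_integral_cong nn_integral_real_affine a) measurable
    also have "\<dots> = ennreal \<bar>a\<bar> * (\<integral>\<^sup>+y. \<integral>\<^sup>+x. f (Complex ((t + b * y) + a * x)
        ((r + c / a * ((t + b * y) + a * x - t)) + e * y)) \<partial>lborel \<partial>lborel)"
      by (rule nn_integral_cmult) measurable
    also have "(\<lambda>y x. f (Complex ((t + b * y) + a * x)
        ((r + c / a * ((t + b * y) + a * x - t)) + e * y))) =
        (\<lambda>y x. f (Complex (t + a * x + b * y) (r + c * x + d * y)))"
      using a by (auto simp: fun_eq_iff e_def field_simps intro!: arg_cong[where f=f])
    finally show ?thesis
      using a by (simp add: e_def mult.assoc[symmetric] ennreal_mult'[symmetric] abs_mult)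
  qed
  show ?thesis
  proof (cases "a = 0")
    case False
    then show ?thesis
      using *[OF False det] by (subst lborel_pair.Fubini'[symmetric]) auto
  next
    case True
    \<comment> \<open>Now \<open>b\<close> serves as pivot. Exchanging the columns also exchanges
      the names of the integration variables, so the integrals already come in the desired
      order.\<close>
    then have "b \<noteq> 0" "b * c - a * d \<noteq> 0" using det by auto
    from *[OF this] show ?thesis
      by (simp add: abs_minus_commute add_ac)
  qed
qed

text \<open>As a real linear map, \<open>\<alpha> * z + \<beta> * cnj z\<close> has the matrix with
  rows \<open>?a\<close>, \<open>?b\<close> and \<open>?c\<close>, \<open>?d\<close>, whose
  determinant is \<open>J\<close>.\<close>

lemma lborel_complex_affine:
  fixes \<kappa> \<alpha> \<beta> :: complex
  defines "J \<equiv> (cmod \<alpha>)\<^sup>2 - (cmod \<beta>)\<^sup>2"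
  assumes J: "J \<noteq> 0"
  shows "lborel = density (distr lborel borel (\<lambda>z. \<kappa> + \<alpha> * z + \<beta> * cnj z)) (\<lambda>_. ennreal \<bar>J\<bar>)"
    (is "_ = density (distr lborel borel ?g) _")
proof (rule measure_eqI)
  have g [measurable]: "?g \<in> borel \<rightarrow>\<^sub>M borel"
    by (intro borel_measurable_continuous_onI continuous_intros)
  let ?a = "Re \<alpha> + Re \<beta>" and ?b = "Im \<beta> - Im \<alpha>" and ?c = "Im \<alpha> + Im \<beta>" and ?d = "Re \<alpha> - Re \<beta>"
  have det: "?a * ?d - ?b * ?c = J"
    unfolding J_def cmod_power2 by (simp add: power2_eq_square algebra_simps)
  fix X :: "complex set"
  assume "X \<in> sets lborel"
  then have X [measurable]: "X \<in> sets borel" by simp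
  have "emeasure lborel X = (\<integral>\<^sup>+z. indicator X z \<partial>lborel)" by simp
  also have "\<dots> = ennreal \<bar>?a * ?d - ?b * ?c\<bar> * (\<integral>\<^sup>+x. \<integral>\<^sup>+y.
      indicator X (Complex (Re \<kappa> + ?a * x + ?b * y) (Im \<kappa> + ?c * x + ?d * y)) \<partial>lborel \<partial>lborel)"
    using J unfolding det[symmetric] by (intro nn_integral_complex_affine_real) auto
  also have "\<dots> = ennreal \<bar>J\<bar> * (\<integral>\<^sup>+x. \<integral>\<^sup>+y. indicator X (?g (Complex x y)) \<partial>lborel \<partial>lborel)"
    unfolding det
    by (intro arg_cong2[where f="(*)"] refl nn_integral_cong arg_cong[where f="indicator X"])
      (simp add: complex_eq_iff algebra_simps)
  also have "\<dots> = ennreal \<bar>J\<bar> * (\<integral>\<^sup>+z. indicator X (?g z) \<partial>lborel)"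
    by (subst nn_integral_lborel_complex) auto
  also have "\<dots> = emeasure (density (distr lborel borel ?g) (\<lambda>_. ennreal \<bar>J\<bar>)) X"
    by (subst nn_integral_indicator[symmetric])
      (simp_all add: nn_integral_density nn_integral_cmult nn_integral_distr del: nn_integral_indicator)
  finally show "emeasure lborel X = emeasure (density (distr lborel borel ?g) (\<lambda>_. ennreal \<bar>J\<bar>)) X" .
qed simp

lemma lborel_integral_complex_affine:
  fixes f :: "complex \<Rightarrow> real"
  assumes [measurable]: "f \<in> borel_measurable borel" and J: "(cmod \<alpha>)\<^sup>2 - (cmod \<beta>)\<^sup>2 \<noteq> 0"
  shows "(\<integral>z. f z \<partial>lborel) = \<bar>(cmod \<alpha>)\<^sup>2 - (cmod \<beta>)\<^sup>2\<bar> * (\<integral>z. f (\<kappa> + \<alpha> * z + \<beta> * cnj z) \<partial>lborel)"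
proof -
  have g [measurable]: "(\<lambda>z. \<kappa> + \<alpha> * z + \<beta> * cnj z) \<in> borel \<rightarrow>\<^sub>M borel"
    by (intro borel_measurable_continuous_onI continuous_intros)
  show ?thesis
    by (subst lborel_complex_affine[OF J, of \<kappa>], subst integral_density)
      (auto simp: integral_distr)
qed

lemma integral_lborel_complex:
  fixes f :: "complex \<Rightarrow> real"
  assumes f: "integrable lborel f"
  shows "(\<integral>z. f z \<partial>lborel) = (\<integral>x. \<integral>y. f (Complex x y) \<partial>lborel \<partial>lborel)"
proof -
  have m [measurable]: "(\<lambda>(x, y). Complex x y) \<in> lborel \<Otimes>\<^sub>M lborel \<rightarrow>\<^sub>M borel"
    by (simp add: case_prod_beta)
  have [measurable]: "f \<in> borel_measurable borel"
    using borel_measurable_integrable[OF f] by simp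
  have "integrable (distr (lborel \<Otimes>\<^sub>M lborel) borel (\<lambda>(x, y). Complex x y)) f"
    using f by (subst (asm) lborel_complex_eq_distr)
  then have "integrable (lborel \<Otimes>\<^sub>M lborel) (\<lambda>p. f (case p of (x, y) \<Rightarrow> Complex x y))"
    by (subst (asm) integrable_distr_eq) auto
  from lborel_pair.integral_fst'[OF this] show ?thesis
    by (subst lborel_complex_eq_distr) (simp add: integral_distr)
qed

subsection \<open>Moments of an equilateral triangle\<close>

text \<open>A rewrite rule for nested products, cancelling pairs of \<open>sqrt 3\<close> in
  normalized expressions.\<close>

lemma sqrt3_mult: "sqrt 3 * (sqrt 3 * x) = 3 * x" for x :: real
  by (simp add: mult.assoc[symmetric])

definition cube_root :: complex where
  "cube_root = Complex (- 1 / 2) (sqrt 3 / 2)"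

definition std_triangle :: "complex set" where
  "std_triangle = convex hull {1, cube_root, cnj cube_root}"

text \<open>Describes the triangle by its vertical sections, which are intervals symmetric about the
  real axis; this is the form needed for iterated integration.\<close>

lemma std_triangle_eq:
  "std_triangle = {z. Re z \<in> {- 1 / 2..1} \<and> Im z \<in> {- ((1 - Re z) / sqrt 3)..(1 - Re z) / sqrt 3}}"
    (is "_ = ?R")
proof
  show "?R \<subseteq> std_triangle"
  proof
    fix z assume z: "z \<in> ?R"
    \<comment> \<open>Barycentric coordinates: \<open>1 - p\<close> is the weight of the vertex 1,
      and \<open>(p + q) / 2\<close>, \<open>(p - q) / 2\<close> are the weights of the two
      conjugate vertices.\<close>
    define p where "p = (2 - 2 * Re z) / 3"
    define q where "q = 2 * Im z / sqrt 3"
    have "z = (1 - p) *\<^sub>R 1 + ((p + q) / 2) *\<^sub>R cube_root + ((p - q) / 2) *\<^sub>R cnj cube_root"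
      by (simp add: complex_eq_iff cube_root_def p_def q_def field_simps sqrt3_mult)
    moreover have "p \<le> 1" using z by (simp add: p_def)
    moreover have "\<bar>q\<bar> \<le> p"
    proof -
      have "\<bar>Im z\<bar> \<le> (1 - Re z) / sqrt 3" using z by auto
      then have "2 / sqrt 3 * \<bar>Im z\<bar> \<le> 2 / sqrt 3 * ((1 - Re z) / sqrt 3)"
        by (intro mult_left_mono) auto
      then show ?thesis by (simp add: p_def q_def abs_mult)
    qed
    ultimately show "z \<in> std_triangle"
      unfolding std_triangle_def convex_hull_3
      by (intro CollectI exI[of _ "1 - p"] exI[of _ "(p + q) / 2"] exI[of _ "(p - q) / 2"])
        (auto simp: field_simps)
  qed
  show "std_triangle \<subseteq> ?R"
    unfolding std_triangle_def
  proof (rule hull_minimal)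
    have "?R = {z. Re z \<ge> - 1 / 2} \<inter> {z. inner (Complex 1 (sqrt 3)) z \<le> 1}
        \<inter> {z. inner (Complex 1 (- sqrt 3)) z \<le> 1}"
      (is "_ = ?S")
    proof (rule set_eqI)
      fix z
      have 1: "- ((1 - Re z) / sqrt 3) \<le> Im z \<longleftrightarrow> Re z - sqrt 3 * Im z \<le> 1"
        "Im z \<le> (1 - Re z) / sqrt 3 \<longleftrightarrow> Re z + sqrt 3 * Im z \<le> 1"
        by (auto simp: field_simps)
      show "z \<in> ?R \<longleftrightarrow> z \<in> ?S"
        by (auto simp: 1 inner_complex_def)
    qed
    also have "convex \<dots>"
      by (intro convex_Int convex_halfspace_Re_ge convex_halfspace_le)
    finally show "convex ?R" .
    show "{1, cube_root, cnj cube_root} \<subseteq> ?R"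
      by (auto simp: cube_root_def field_simps)
  qed
qed

lemma compact_std_triangle: "compact std_triangle"
  unfolding std_triangle_def by (intro compact_convex_hull finite_imp_compact) simp

abbreviation std_triangle_moment :: "nat \<Rightarrow> nat \<Rightarrow> real \<Rightarrow> bool" where
  "std_triangle_moment i j m \<equiv>
    has_bochner_integral lborel (\<lambda>z. indicator std_triangle z * (Re z ^ i * Im z ^ j)) m"

text \<open>Integrating the power of \<open>Im z\<close> over a vertical section leaves a function
  of \<open>x\<close> with antiderivative \<open>F\<close>, so each moment costs one differentiation
  and two evaluations.\<close>

lemma std_triangle_monomial:
  assumes F: "\<And>x. (F has_real_derivative
      x ^ i * ((((1 - x) / sqrt 3) ^ Suc j - (- ((1 - x) / sqrt 3)) ^ Suc j) / Suc j)) (at x)"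
    and m: "m = F 1 - F (- 1 / 2)"
  shows "std_triangle_moment i j m"
proof -
  let ?f = "\<lambda>z. indicator std_triangle z * (Re z ^ i * Im z ^ j)"
  let ?h = "\<lambda>x. (1 - x) / sqrt 3 :: real"
  have int: "integrable lborel ?f"
    using borel_integrable_compact[OF compact_std_triangle, of "\<lambda>z. Re z ^ i * Im z ^ j"]
    by (simp add: continuous_intros)
  have inner: "(\<integral>y. ?f (Complex x y) \<partial>lborel) =
      x ^ i * ((?h x ^ Suc j - (- ?h x) ^ Suc j) / Suc j) * indicator {- 1 / 2..1} x" for x
  proof (cases "x \<in> {- 1 / 2..1}")
    case True
    then have h: "- ?h x \<le> ?h x" by simp
    have "(\<lambda>y. ?f (Complex x y)) = (\<lambda>y. x ^ i * (y ^ j * indicator {- ?h x..?h x} y))"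
      using True by (auto simp: std_triangle_eq indicator_def)
    then show ?thesis
      using True integral_power[OF h, of j] by simp
  qed (auto simp: std_triangle_eq)
  have "(\<integral>z. ?f z \<partial>lborel) = F 1 - F (- 1 / 2)"
    unfolding integral_lborel_complex[OF int] inner
    by (rule integral_FTC_Icc_real[OF _ F]) (auto intro!: continuous_intros)
  with int show ?thesis
    by (simp add: m has_bochner_integral_iff)
qed

lemma std_triangle_monomial_odd:
  assumes "odd j"
  shows "std_triangle_moment i j 0"
  by (rule std_triangle_monomial[where F = "\<lambda>x. 0"]) (use assms in auto)

text \<open>Order four suffices because the integrands will be squares of quadratics. The nonzero
  values are written as the area \<open>3 * sqrt 3 / 4\<close> times the mean of the
  monomial.\<close>

lemma std_triangle_moments:
  shows "std_triangle_moment 0 0 (3 * sqrt 3 / 4)"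
    and "std_triangle_moment 1 0 0"
    and "std_triangle_moment 0 1 0"
    and "std_triangle_moment 2 0 (3 * sqrt 3 / 4 * (1 / 8))"
    and "std_triangle_moment 1 1 0"
    and "std_triangle_moment 0 2 (3 * sqrt 3 / 4 * (1 / 8))"
    and "std_triangle_moment 3 0 (3 * sqrt 3 / 4 * (1 / 40))"
    and "std_triangle_moment 2 1 0"
    and "std_triangle_moment 1 2 (3 * sqrt 3 / 4 * (- 1 / 40))"
    and "std_triangle_moment 0 3 0"
    and "std_triangle_moment 4 0 (3 * sqrt 3 / 4 * (3 / 80))"
    and "std_triangle_moment 3 1 0"
    and "std_triangle_moment 2 2 (3 * sqrt 3 / 4 * (1 / 80))"
    and "std_triangle_moment 1 3 0"
    and "std_triangle_moment 0 4 (3 * sqrt 3 / 4 * (3 / 80))"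
proof -
  note der = derivative_eq_intros
  show "std_triangle_moment 0 0 (3 * sqrt 3 / 4)"
    by (rule std_triangle_monomial[where F = "\<lambda>x. 2 / sqrt 3 * (x - x^2 / 2)"])
      (auto intro!: der simp: field_simps eval_nat_numeral sqrt3_mult)
  show "std_triangle_moment 1 0 0"
    by (rule std_triangle_monomial[where F = "\<lambda>x. 2 / sqrt 3 * (x^2/2 - x^3 / 3)"])
      (auto intro!: der simp: field_simps eval_nat_numeral sqrt3_mult)
  show "std_triangle_moment 2 0 (3 * sqrt 3 / 4 * (1 / 8))"
    by (rule std_triangle_monomial[where F = "\<lambda>x. 2 / sqrt 3 * (x^3/3 - x^4 / 4)"])
      (auto intro!: der simp: field_simps eval_nat_numeral sqrt3_mult)
  show "std_triangle_moment 3 0 (3 * sqrt 3 / 4 * (1 / 40))"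
    by (rule std_triangle_monomial[where F = "\<lambda>x. 2 / sqrt 3 * (x^4/4 - x^5 / 5)"])
      (auto intro!: der simp: field_simps eval_nat_numeral sqrt3_mult)
  show "std_triangle_moment 4 0 (3 * sqrt 3 / 4 * (3 / 80))"
    by (rule std_triangle_monomial[where F = "\<lambda>x. 2 / sqrt 3 * (x^5/5 - x^6 / 6)"])
      (auto intro!: der simp: field_simps eval_nat_numeral sqrt3_mult)
  show "std_triangle_moment 0 2 (3 * sqrt 3 / 4 * (1 / 8))"
    by (rule std_triangle_monomial[where F = "\<lambda>x. 2 / (3 * sqrt 3 ^ 3) * (x - 3 * x^2/2 + x^3 - x^4 / 4)"])
      (auto intro!: der simp: field_simps eval_nat_numeral sqrt3_mult)
  show "std_triangle_moment 1 2 (3 * sqrt 3 / 4 * (- 1 / 40))"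
    by (rule std_triangle_monomial[where F = "\<lambda>x. 2 / (3 * sqrt 3 ^ 3) * (x^2/2 - x^3 + 3 * x^4/4 - x^5 / 5)"])
      (auto intro!: der simp: field_simps eval_nat_numeral sqrt3_mult)
  show "std_triangle_moment 2 2 (3 * sqrt 3 / 4 * (1 / 80))"
    by (rule std_triangle_monomial[where F = "\<lambda>x. 2 / (3 * sqrt 3 ^ 3) * (x^3/3 - 3 * x^4/4 + 3 * x^5/5 - x^6 / 6)"])
      (auto intro!: der simp: field_simps eval_nat_numeral sqrt3_mult)
  show "std_triangle_moment 0 4 (3 * sqrt 3 / 4 * (3 / 80))"
    by (rule std_triangle_monomial[where F = "\<lambda>x. - 2 / (5 * sqrt 3 ^ 5) * (1 - x)^6 / 6"])
      (auto intro!: der simp: field_simps eval_nat_numeral sqrt3_mult)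
qed (rule std_triangle_monomial_odd; simp)+

text \<open>The square is expanded into monomials and integrated termwise. Up to the area factor,
  the result is the Gram form of the real monomials of degree at most two.\<close>

lemma std_triangle_real_quadratic:
  "has_bochner_integral lborel
    (\<lambda>z. indicator std_triangle z * (r0 + r1 * Re z + r2 * Im z + r3 * (Re z)\<^sup>2 + r4 * (Re z * Im z) + r5 * (Im z)\<^sup>2)\<^sup>2)
    (3 * sqrt 3 / 4 * (r0\<^sup>2 + (r1\<^sup>2 + r2\<^sup>2) / 8 + r0 * (r3 + r5) / 4 + r1 * (r3 - r5) / 20 - r2 * r4 / 20
      + (3 * r3\<^sup>2 + 3 * r5\<^sup>2 + r4\<^sup>2 + 2 * r3 * r5) / 80))"
proof -
  define X :: "nat \<Rightarrow> nat \<Rightarrow> complex \<Rightarrow> real"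
    where "X i j = (\<lambda>z. indicator std_triangle z * (Re z ^ i * Im z ^ j))" for i j
  note m = std_triangle_moments[folded X_def]
  have "has_bochner_integral lborel (\<lambda>z.
      r0\<^sup>2 * X 0 0 z + 2 * r0 * r1 * X 1 0 z + 2 * r0 * r2 * X 0 1 z
      + (r1\<^sup>2 + 2 * r0 * r3) * X 2 0 z + (2 * r1 * r2 + 2 * r0 * r4) * X 1 1 z + (r2\<^sup>2 + 2 * r0 * r5) * X 0 2 z
      + 2 * r1 * r3 * X 3 0 z + (2 * r1 * r4 + 2 * r2 * r3) * X 2 1 z
      + (2 * r1 * r5 + 2 * r2 * r4) * X 1 2 z + 2 * r2 * r5 * X 0 3 z
      + r3\<^sup>2 * X 4 0 z + 2 * r3 * r4 * X 3 1 z + (r4\<^sup>2 + 2 * r3 * r5) * X 2 2 z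
      + 2 * r4 * r5 * X 1 3 z + r5\<^sup>2 * X 0 4 z)
    (r0\<^sup>2 * (3 * sqrt 3 / 4) + 2 * r0 * r1 * 0 + 2 * r0 * r2 * 0
      + (r1\<^sup>2 + 2 * r0 * r3) * (3 * sqrt 3 / 4 * (1 / 8)) + (2 * r1 * r2 + 2 * r0 * r4) * 0
      + (r2\<^sup>2 + 2 * r0 * r5) * (3 * sqrt 3 / 4 * (1 / 8))
      + 2 * r1 * r3 * (3 * sqrt 3 / 4 * (1 / 40)) + (2 * r1 * r4 + 2 * r2 * r3) * 0
      + (2 * r1 * r5 + 2 * r2 * r4) * (3 * sqrt 3 / 4 * (- 1 / 40)) + 2 * r2 * r5 * 0
      + r3\<^sup>2 * (3 * sqrt 3 / 4 * (3 / 80)) + 2 * r3 * r4 * 0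
      + (r4\<^sup>2 + 2 * r3 * r5) * (3 * sqrt 3 / 4 * (1 / 80))
      + 2 * r4 * r5 * 0 + r5\<^sup>2 * (3 * sqrt 3 / 4 * (3 / 80)))"
    by (intro has_bochner_integral_add has_bochner_integral_mult_right) (rule m)+
  then show ?thesis
    by (rule has_bochner_integral_cong[THEN iffD1, rotated -1])
      (simp_all add: X_def eval_nat_numeral, simp_all add: algebra_simps add_divide_distrib diff_divide_distrib)
qed

text \<open>The threefold symmetry explains the shape: the mean of \<open>z ^ i * cnj z ^ j\<close>
  vanishes unless i and j agree modulo 3, which leaves just three cross terms. The derivation
  applies the real formula to the real and imaginary parts.\<close>

lemma std_triangle_complex_quadratic:
  "(LINT z:std_triangle|lborel.
      (cmod (c00 + c10 * z + c01 * cnj z + c20 * z\<^sup>2 + c11 * (z * cnj z) + c02 * (cnj z)\<^sup>2))\<^sup>2)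
    = 3 * sqrt 3 / 4 * ((cmod c00)\<^sup>2 + Re (c00 * cnj c11) / 2 + ((cmod c10)\<^sup>2 + (cmod c01)\<^sup>2) / 4
      + ((cmod c20)\<^sup>2 + (cmod c11)\<^sup>2 + (cmod c02)\<^sup>2) / 10
      + Re (c10 * cnj c02) / 5 + Re (c20 * cnj c01) / 5)"
proof -
  define V :: "real \<Rightarrow> real \<Rightarrow> real \<Rightarrow> real \<Rightarrow> real \<Rightarrow> real \<Rightarrow> real" where
    "V r0 r1 r2 r3 r4 r5 = r0\<^sup>2 + (r1\<^sup>2 + r2\<^sup>2) / 8 + r0 * (r3 + r5) / 4 + r1 * (r3 - r5) / 20
      - r2 * r4 / 20 + (3 * r3\<^sup>2 + 3 * r5\<^sup>2 + r4\<^sup>2 + 2 * r3 * r5) / 80" for r0 r1 r2 r3 r4 r5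
  let ?q = "\<lambda>r0 r1 r2 r3 r4 r5 z.
    (r0 + r1 * Re z + r2 * Im z + r3 * (Re z)\<^sup>2 + r4 * (Re z * Im z) + r5 * (Im z)\<^sup>2)\<^sup>2"
  have "(cmod (c00 + c10 * z + c01 * cnj z + c20 * z\<^sup>2 + c11 * (z * cnj z) + c02 * (cnj z)\<^sup>2))\<^sup>2
    = ?q (Re c00) (Re c10 + Re c01) (Im c01 - Im c10) (Re c20 + Re c11 + Re c02)
        (2 * Im c02 - 2 * Im c20) (Re c11 - Re c20 - Re c02) z
    + ?q (Im c00) (Im c10 + Im c01) (Re c10 - Re c01) (Im c20 + Im c11 + Im c02)
        (2 * Re c20 - 2 * Re c02) (Im c11 - Im c20 - Im c02) z" for z
    unfolding cmod_power2
    by (intro arg_cong2[where f="(+)"] arg_cong[where f="\<lambda>x. x\<^sup>2"])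
      (simp_all add: power2_eq_square algebra_simps)
  note eq = this
  define W where "W = (cmod c00)\<^sup>2 + Re (c00 * cnj c11) / 2 + ((cmod c10)\<^sup>2 + (cmod c01)\<^sup>2) / 4
      + ((cmod c20)\<^sup>2 + (cmod c11)\<^sup>2 + (cmod c02)\<^sup>2) / 10
      + Re (c10 * cnj c02) / 5 + Re (c20 * cnj c01) / 5"
  have V: "V r0 r1 r2 r3 r4 r5 + V t0 t1 t2 t3 t4 t5 = W"
    if "r0 = Re c00" "r1 = Re c10 + Re c01" "r2 = Im c01 - Im c10" "r3 = Re c20 + Re c11 + Re c02"
      "r4 = 2 * Im c02 - 2 * Im c20" "r5 = Re c11 - Re c20 - Re c02"
      "t0 = Im c00" "t1 = Im c10 + Im c01" "t2 = Re c10 - Re c01" "t3 = Im c20 + Im c11 + Im c02"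
      "t4 = 2 * Re c20 - 2 * Re c02" "t5 = Im c11 - Im c20 - Im c02"
    for r0 r1 r2 r3 r4 r5 t0 t1 t2 t3 t4 t5
  proof -
    \<comment> \<open>The fractions are combined on opaque variables, separately from the polynomial
      identities \<open>1\<close> to \<open>5\<close>.\<close>
    have arith: "A + 2 * (B + C) / 8 + 2 * D / 4 + 4 * (E + F) / 20 + 8 * (G + H + I) / 80
        = A + D / 2 + (B + C) / 4 + (G + H + I) / 10 + E / 5 + F / 5" for A B C D E F G H I :: real
      by (simp add: field_simps)
    have 1: "r0\<^sup>2 + t0\<^sup>2 = (cmod c00)\<^sup>2"
      by (simp add: that cmod_power2)
    have 2: "(r1\<^sup>2 + r2\<^sup>2) + (t1\<^sup>2 + t2\<^sup>2) = 2 * ((cmod c10)\<^sup>2 + (cmod c01)\<^sup>2)"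
      unfolding that cmod_power2 by (simp add: power2_eq_square algebra_simps)
    have 3: "r0 * (r3 + r5) + t0 * (t3 + t5) = 2 * Re (c00 * cnj c11)"
      by (simp add: that algebra_simps)
    have 4: "(r1 * (r3 - r5) - r2 * r4) + (t1 * (t3 - t5) - t2 * t4)
        = 4 * (Re (c10 * cnj c02) + Re (c20 * cnj c01))"
      by (simp add: that algebra_simps)
    have 5: "(3 * r3\<^sup>2 + 3 * r5\<^sup>2 + r4\<^sup>2 + 2 * r3 * r5) + (3 * t3\<^sup>2 + 3 * t5\<^sup>2 + t4\<^sup>2 + 2 * t3 * t5)
        = 8 * ((cmod c20)\<^sup>2 + (cmod c11)\<^sup>2 + (cmod c02)\<^sup>2)"
      unfolding that cmod_power2 by (simp add: power2_eq_square algebra_simps)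
    have "V r0 r1 r2 r3 r4 r5 + V t0 t1 t2 t3 t4 t5
        = (r0\<^sup>2 + t0\<^sup>2) + ((r1\<^sup>2 + r2\<^sup>2) + (t1\<^sup>2 + t2\<^sup>2)) / 8 + (r0 * (r3 + r5) + t0 * (t3 + t5)) / 4
          + ((r1 * (r3 - r5) - r2 * r4) + (t1 * (t3 - t5) - t2 * t4)) / 20
          + ((3 * r3\<^sup>2 + 3 * r5\<^sup>2 + r4\<^sup>2 + 2 * r3 * r5) + (3 * t3\<^sup>2 + 3 * t5\<^sup>2 + t4\<^sup>2 + 2 * t3 * t5)) / 80"
      unfolding V_def by (simp add: add_divide_distrib diff_divide_distrib)
    also have "\<dots> = W"
      unfolding 1 2 3 4 5 W_def by (rule arith)
    finally show ?thesis .
  qed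
  show ?thesis
    unfolding set_lebesgue_integral_def real_scaleR_def eq W_def[symmetric]
    by (subst V[OF refl refl refl refl refl refl refl refl refl refl refl refl, symmetric],
        unfold distrib_left,
        intro has_bochner_integral_integral_eq has_bochner_integral_add
          std_triangle_real_quadratic[folded V_def])
qed

subsection \<open>Bounds for affine images\<close>

text \<open>To be used with the moduli of \<alpha> and \<beta> as \<open>a\<close> and
  \<open>b\<close>: it compares the value of the test polynomial, per unit area, with the
  equilateral value. In terms of \<open>s\<close> and \<open>x\<close>, where
  \<open>D\<^sup>2 = s\<^sup>2 - 4 * x\<^sup>2\<close>, it reduces to a polynomial
  inequality.\<close>

lemma real_key_inequality:
  fixes a b Q :: real
  assumes ab: "0 \<le> b" "b < a" and Q: "(a ^ 3 - b ^ 3)\<^sup>2 \<le> Q"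
  defines "s \<equiv> a\<^sup>2 + b\<^sup>2" and "D \<equiv> a\<^sup>2 - b\<^sup>2" and "x \<equiv> a * b"
  shows "D\<^sup>2 / (4 * s) - D\<^sup>2 * Q * (2 * s\<^sup>2 + x\<^sup>2) / (20 * s ^ 6) \<le> 3 / 20 * D"
    and "b > 0 \<Longrightarrow> D\<^sup>2 / (4 * s) - D\<^sup>2 * Q * (2 * s\<^sup>2 + x\<^sup>2) / (20 * s ^ 6) < 3 / 20 * D"
proof -
  have a0: "a > 0" using ab by simp
  have s0: "s > 0" using a0 by (simp add: s_def add_pos_nonneg)
  have D0: "D > 0" using ab by (simp add: D_def power_strict_mono)
  have x0: "x \<ge> 0" using ab by (simp add: x_def)
  have sx: "2 * x \<le> s" using zero_le_power2[of "a - b"] by (simp add: x_def s_def power2_diff)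
  have DD: "D\<^sup>2 = s\<^sup>2 - 4 * x\<^sup>2"
    by (simp add: D_def s_def x_def power2_eq_square algebra_simps)
  have Q': "Q \<ge> s ^ 3 - 3 * x\<^sup>2 * s - 2 * x ^ 3"
    using Q by (simp add: s_def x_def eval_nat_numeral algebra_simps)
  \<comment> \<open>This is \<open>5 * s ^ 5 - Q * (2 * s\<^sup>2 + x\<^sup>2)\<close> at the
    smallest admissible \<open>Q\<close>. As \<open>P\<close> is positive, an upper bound for
    \<open>D\<close> is enough from here on.\<close>
  define P where "P = 3 * s ^ 5 + 5 * s ^ 3 * x\<^sup>2 + 4 * x ^ 3 * s\<^sup>2 + 3 * x ^ 4 * s + 2 * x ^ 5"
  have P0: "P > 0" unfolding P_def using s0 x0 by (intro add_pos_nonneg) auto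
  have xx: "2 * x\<^sup>2 \<le> s\<^sup>2"
  proof -
    have "(2 * x)\<^sup>2 \<le> s\<^sup>2" using sx x0 by (intro power_mono) auto
    then have "4 * x\<^sup>2 \<le> s\<^sup>2" by (simp add: power_mult_distrib)
    with zero_le_power2[of x] show ?thesis by linarith
  qed
  \<comment> \<open>Removes the square root hidden in \<open>D\<close> by completing the square in
    \<open>s ^ 4 - 4 * x\<^sup>2 * s\<^sup>2\<close>.\<close>
  have Ds: "D * s \<le> s\<^sup>2 - 2 * x\<^sup>2"
  proof (rule power2_le_imp_le)
    have "(D * s)\<^sup>2 = (s\<^sup>2 - 4 * x\<^sup>2) * s\<^sup>2" by (simp add: DD power_mult_distrib)
    also have "\<dots> = (s\<^sup>2 - 2 * x\<^sup>2)\<^sup>2 - 4 * (x\<^sup>2)\<^sup>2" by (simp add: power2_eq_square algebra_simps)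
    also have "\<dots> \<le> (s\<^sup>2 - 2 * x\<^sup>2)\<^sup>2" by simp
    finally show "(D * s)\<^sup>2 \<le> (s\<^sup>2 - 2 * x\<^sup>2)\<^sup>2" .
  qed (use xx in simp)
  \<comment> \<open>Chosen so that
    \<open>(s\<^sup>2 - 2 * x\<^sup>2) * P = 3 * s ^ 7 - x\<^sup>2 * R\<close>. The square absorbs
    the only negative term, \<open>- 4 * x * s ^ 4\<close>, and the factor \<open>x\<^sup>2\<close>
    makes the inequality strict when \<open>b > 0\<close>.\<close>
  define R where "R = s ^ 3 * ((s - 2 * x)\<^sup>2 + 3 * x\<^sup>2) + 6 * x ^ 3 * s\<^sup>2 + 6 * x ^ 4 * s + 4 * x ^ 5"
  have R0: "R \<ge> 0" unfolding R_def using s0 x0 by (intro add_nonneg_nonneg mult_nonneg_nonneg) auto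
  have Rp: "R > 0" if "x > 0" unfolding R_def using s0 that by (intro add_pos_pos mult_pos_pos add_nonneg_pos) auto
  have "D * s * P \<le> (s\<^sup>2 - 2 * x\<^sup>2) * P"
    using Ds P0 by (intro mult_right_mono) auto
  also have "\<dots> = 3 * s ^ 7 - x\<^sup>2 * R"
    unfolding P_def R_def by (simp add: eval_nat_numeral algebra_simps)
  finally have main: "D * s * P \<le> 3 * s ^ 7 - x\<^sup>2 * R" .
  have "D * (5 * s ^ 5 - Q * (2 * s\<^sup>2 + x\<^sup>2)) \<le> D * P"
  proof (rule mult_left_mono)
    have "(s ^ 3 - 3 * x\<^sup>2 * s - 2 * x ^ 3) * (2 * s\<^sup>2 + x\<^sup>2) \<le> Q * (2 * s\<^sup>2 + x\<^sup>2)"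
      by (rule mult_right_mono[OF Q']) simp
    moreover have "(s ^ 3 - 3 * x\<^sup>2 * s - 2 * x ^ 3) * (2 * s\<^sup>2 + x\<^sup>2) = 5 * s ^ 5 - P"
      unfolding P_def by (simp add: eval_nat_numeral algebra_simps)
    ultimately show "5 * s ^ 5 - Q * (2 * s\<^sup>2 + x\<^sup>2) \<le> P" by simp
  qed (use D0 in simp)
  then have "D * (5 * s ^ 5 - Q * (2 * s\<^sup>2 + x\<^sup>2)) * s \<le> D * P * s"
    using s0 by (intro mult_right_mono) auto
  with main have fin: "D * (5 * s ^ 5 - Q * (2 * s\<^sup>2 + x\<^sup>2)) * s \<le> 3 * s ^ 7 - x\<^sup>2 * R"
    by (simp add: mult_ac)
  have eq: "3 / 20 * D - (D\<^sup>2 / (4 * s) - D\<^sup>2 * Q * (2 * s\<^sup>2 + x\<^sup>2) / (20 * s ^ 6))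
      = D / (20 * s ^ 7) * (3 * s ^ 7 - D * (5 * s ^ 5 - Q * (2 * s\<^sup>2 + x\<^sup>2)) * s)"
    using s0 by (simp add: field_simps eval_nat_numeral)
  have c: "D / (20 * s ^ 7) > 0" using D0 s0 by simp
  have "3 * s ^ 7 - D * (5 * s ^ 5 - Q * (2 * s\<^sup>2 + x\<^sup>2)) * s \<ge> 0"
    using fin R0 by (smt (verit) mult_nonneg_nonneg zero_le_power2)
  with c eq show "D\<^sup>2 / (4 * s) - D\<^sup>2 * Q * (2 * s\<^sup>2 + x\<^sup>2) / (20 * s ^ 6) \<le> 3 / 20 * D"
    by (smt (verit) mult_nonneg_nonneg)
  assume "b > 0"
  then have "x > 0" using a0 by (simp add: x_def)
  then have "x\<^sup>2 * R > 0" using Rp by simp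
  with fin have "3 * s ^ 7 - D * (5 * s ^ 5 - Q * (2 * s\<^sup>2 + x\<^sup>2)) * s > 0" by simp
  with c eq show "D\<^sup>2 / (4 * s) - D\<^sup>2 * Q * (2 * s\<^sup>2 + x\<^sup>2) / (20 * s ^ 6) < 3 / 20 * D"
    by (smt (verit) mult_pos_pos)
qed

section \<open>Affine images of the fixed triangle\<close>

lemma complex_affine_convex_hull:
  fixes \<kappa> \<alpha> \<beta> :: complex
  shows "convex hull {\<kappa> + \<alpha> + \<beta>, \<kappa> + \<alpha> * cube_root + \<beta> * cnj cube_root, \<kappa> + \<alpha> * cnj cube_root + \<beta> * cube_root}
    = (\<lambda>z. \<kappa> + \<alpha> * z + \<beta> * cnj z) ` std_triangle"
proof -
  have lin: "linear (\<lambda>z. \<alpha> * z + \<beta> * cnj z)"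
    by (rule linearI) (simp_all add: algebra_simps scaleR_conv_of_real)
  have "(\<lambda>z. \<kappa> + \<alpha> * z + \<beta> * cnj z) ` std_triangle = (+) \<kappa> ` (\<lambda>z. \<alpha> * z + \<beta> * cnj z) ` std_triangle"
    by (simp add: image_image add.assoc)
  also have "\<dots> = convex hull ((+) \<kappa> ` (\<lambda>z. \<alpha> * z + \<beta> * cnj z) ` {1, cube_root, cnj cube_root})"
    unfolding std_triangle_def convex_hull_linear_image[OF lin] convex_hull_translation ..
  finally show ?thesis by (simp add: add.assoc)
qed

lemma complex_affine_inj:
  fixes \<kappa> \<alpha> \<beta> :: complex
  assumes "(cmod \<alpha>)\<^sup>2 - (cmod \<beta>)\<^sup>2 \<noteq> 0"
  shows "inj (\<lambda>z. \<kappa> + \<alpha> * z + \<beta> * cnj z)"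
proof (rule injI)
  fix y z assume "\<kappa> + \<alpha> * y + \<beta> * cnj y = \<kappa> + \<alpha> * z + \<beta> * cnj z"
  then have "\<alpha> * (y - z) = - (\<beta> * cnj (y - z))"
    by (simp add: algebra_simps add_eq_0_iff2)
  then have "cmod \<alpha> * cmod (y - z) = cmod \<beta> * cmod (y - z)"
    by (metis norm_mult norm_minus_cancel complex_mod_cnj)
  then show "y = z" using assms by auto
qed

text \<open>Convex sets have null frontier, so under an integral an open triangle may be replaced by
  its closed hull.\<close>

lemma AE_interior_convex:
  fixes S :: "complex set"
  assumes "convex S" "closed S"
  shows "AE z in lborel. z \<in> interior S \<longleftrightarrow> z \<in> S"
proof -
  have "frontier S \<in> null_sets lborel"
    using negligible_convex_frontier[OF assms(1)]
    by (simp add: negligible_iff_null_sets null_sets_completion_iff)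
  then have "AE z in lborel. z \<notin> frontier S"
    by (rule AE_not_in)
  then show ?thesis
    by eventually_elim (use assms interior_subset in \<open>auto simp: frontier_def\<close>)
qed

text \<open>The strict inequality says that the affine map is invertible and preserves orientation.
  The vertices are spelled out so that \<open>T\<close> has the form required by
  \<open>triangle_with_vertices\<close>.\<close>

locale affine_triangle =
  fixes \<kappa> \<alpha> \<beta> :: complex and T :: "complex set"
  assumes det_pos: "cmod \<beta> < cmod \<alpha>"
    and T_eq: "T = interior (convex hull
      {\<kappa> + \<alpha> + \<beta>, \<kappa> + \<alpha> * cube_root + \<beta> * cnj cube_root, \<kappa> + \<alpha> * cnj cube_root + \<beta> * cube_root})"
begin

abbreviation J where "J \<equiv> (cmod \<alpha>)\<^sup>2 - (cmod \<beta>)\<^sup>2"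

lemma J_pos: "J > 0"
  using det_pos by (simp add: power_strict_mono)

lemma set_integral_eq:
  fixes f :: "complex \<Rightarrow> real"
  assumes [measurable]: "f \<in> borel_measurable borel"
  shows "(LINT z:T|lborel. f z) = J * (LINT z:std_triangle|lborel. f (\<kappa> + \<alpha> * z + \<beta> * cnj z))"
proof -
  let ?g = "\<lambda>z. \<kappa> + \<alpha> * z + \<beta> * cnj z"
  let ?S = "?g ` std_triangle"
  have S: "compact ?S" "convex ?S"
    using compact_convex_hull[of "{\<kappa> + \<alpha> + \<beta>, \<kappa> + \<alpha> * cube_root + \<beta> * cnj cube_root, \<kappa> + \<alpha> * cnj cube_root + \<beta> * cube_root}"]
    unfolding complex_affine_convex_hull[symmetric] by (auto intro: finite_imp_compact convex_convex_hull)
  then have cl: "closed ?S" by (simp add: compact_imp_closed)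
  then have [measurable]: "?S \<in> sets borel" by auto
  have [measurable]: "T \<in> sets borel" unfolding T_eq by auto
  have "(LINT z:T|lborel. f z) = (\<integral>z. indicator ?S z * f z \<partial>lborel)"
    unfolding set_lebesgue_integral_def real_scaleR_def
  proof (rule integral_cong_AE)
    show "AE z in lborel. indicator T z * f z = indicator ?S z * f z"
      using AE_interior_convex[OF S(2) cl]
      by eventually_elim (auto simp: T_eq complex_affine_convex_hull indicator_def)
  qed measurable
  also have "\<dots> = J * (\<integral>z. indicator ?S (?g z) * f (?g z) \<partial>lborel)"
    using J_pos by (subst lborel_integral_complex_affine[where \<kappa>=\<kappa> and \<alpha>=\<alpha> and \<beta>=\<beta>]) auto
  finally have eq: "(LINT z:T|lborel. f z) = J * (\<integral>z. indicator ?S (?g z) * f (?g z) \<partial>lborel)" .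
  have "?g z \<in> ?S \<longleftrightarrow> z \<in> std_triangle" for z
    by (rule inj_image_mem_iff[OF complex_affine_inj]) (use J_pos in auto)
  then have "(\<lambda>z. indicator ?S (?g z) * f (?g z)) = (\<lambda>z. indicator std_triangle z * f (?g z))"
    by (simp only: indicator_def)
  with eq show ?thesis
    by (simp add: set_lebesgue_integral_def)
qed

lemma area_eq: "area T = J * (3 * sqrt 3 / 4)"
proof -
  have [measurable]: "T \<in> sets borel" unfolding T_eq by auto
  have "area T = (LINT z:T|lborel. 1)"
    by (simp add: area_def set_lebesgue_integral_def)
  also have "\<dots> = J * (LINT z:std_triangle|lborel. 1)"
    by (rule set_integral_eq) simp
  also have "(LINT z:std_triangle|lborel. 1) = 3 * sqrt 3 / 4"
    using has_bochner_integral_integral_eq[OF std_triangle_moments(1)]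
    by (simp add: set_lebesgue_integral_def)
  finally show ?thesis .
qed

lemma rho2_le:
  assumes "degree p \<le> 2"
  shows "rho2 T \<le> (LINT z:T|lborel. (cmod (cnj z - poly p z))\<^sup>2)"
  unfolding rho2_def
proof (rule cINF_lower)
  show "bdd_below ((\<lambda>p. LINT z:T|lborel. (cmod (cnj z - poly p z))\<^sup>2) ` {p. degree p \<le> 2})"
    by (intro bdd_belowI[of _ 0]) (auto simp: set_lebesgue_integral_def intro!: integral_nonneg_AE)
qed (use assms in simp)

text \<open>The test polynomial is \<open>cnj \<kappa> + c1 w + c2 (w\<^sup>2 - \<alpha> \<beta> / 2)\<close> with \<open>w = z - \<kappa>\<close>. Here \<open>c1\<close> projects
  \<open>cnj w\<close> to the orthogonal complement of \<open>w\<close>, and \<open>c2\<close> is optimal only to leading order in \<open>\<beta>\<close>,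
  which suffices and avoids the determinant of the full Gram matrix.\<close>

lemma rho2_upper:
  defines "s \<equiv> (cmod \<alpha>)\<^sup>2 + (cmod \<beta>)\<^sup>2" and "x \<equiv> cmod \<alpha> * cmod \<beta>"
    and "Q \<equiv> (cmod (\<alpha> ^ 3 - \<beta> ^ 3))\<^sup>2"
  shows "rho2 T \<le> area T * (J\<^sup>2 / (4 * s) - J\<^sup>2 * Q * (2 * s\<^sup>2 + x\<^sup>2) / (20 * s ^ 6))"
proof -
  define a where "a = cmod \<alpha>"
  define b where "b = cmod \<beta>"
  have a0: "a > 0" unfolding a_def by (rule le_less_trans[OF norm_ge_zero det_pos])
  have s0: "s > 0" using a0 by (simp add: s_def a_def[symmetric] add_pos_nonneg)
  define D where "D = J"
  define \<sigma> where "\<sigma> = complex_of_real s"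
  have \<sigma>0: "\<sigma> \<noteq> 0" using s0 by (simp add: \<sigma>_def)
  have \<sigma>: "\<sigma> = \<alpha> * cnj \<alpha> + \<beta> * cnj \<beta>"
    by (simp add: \<sigma>_def s_def complex_norm_square[symmetric])
  have D: "complex_of_real D = \<alpha> * cnj \<alpha> - \<beta> * cnj \<beta>"
    by (simp add: D_def complex_norm_square[symmetric])
  define c1 where "c1 = 2 * cnj \<alpha> * cnj \<beta> / \<sigma>"
  \<comment> \<open>In the mean over the triangle, the residual left by \<open>c1\<close> has inner
    product \<open>D / (10 * s) * cnj (\<alpha> ^ 3 - \<beta> ^ 3)\<close> with
    \<open>w\<^sup>2\<close>. Dividing by \<open>s\<^sup>2 / 10\<close>, which stands in for the
    exact squared norm, gives \<open>c2\<close>.\<close>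
  define c2 where "c2 = of_real (D / s ^ 3) * cnj (\<alpha> ^ 3 - \<beta> ^ 3)"
  define p where "p = [:cnj \<kappa> - c1 * \<kappa> + c2 * \<kappa>\<^sup>2 - c2 * \<alpha> * \<beta> / 2, c1 - 2 * c2 * \<kappa>, c2:]"
  have dp: "degree p \<le> 2" by (simp add: p_def degree_pCons_le order_trans[OF degree_pCons_le])
  \<comment> \<open>The residual left by \<open>c1\<close> is thus \<open>D / s\<close> times
    \<open>cnj \<alpha> * cnj z - cnj \<beta> * z\<close>, whose mean square is the main term
    \<open>D\<^sup>2 / (4 * s)\<close>.\<close>
  have c1a: "cnj \<beta> - c1 * \<alpha> = - (cnj \<beta> * of_real (D / s))"
    using \<sigma>0 by (simp add: c1_def D \<sigma>_def[symmetric] field_simps) (simp add: \<sigma> algebra_simps)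
  have c1b: "cnj \<alpha> - c1 * \<beta> = cnj \<alpha> * of_real (D / s)"
    using \<sigma>0 by (simp add: c1_def D \<sigma>_def[symmetric] field_simps) (simp add: \<sigma> algebra_simps)
  have "cnj (\<kappa> + \<alpha> * z + \<beta> * cnj z) - poly p (\<kappa> + \<alpha> * z + \<beta> * cnj z)
      = c2 * \<alpha> * \<beta> / 2 + (cnj \<beta> - c1 * \<alpha>) * z + (cnj \<alpha> - c1 * \<beta>) * cnj z + (- c2 * \<alpha>\<^sup>2) * z\<^sup>2
        + (- 2 * c2 * \<alpha> * \<beta>) * (z * cnj z) + (- c2 * \<beta>\<^sup>2) * (cnj z)\<^sup>2" for z
    by (simp add: p_def power2_eq_square algebra_simps)
  note h = this[unfolded c1a c1b]
  have "rho2 T \<le> (LINT z:T|lborel. (cmod (cnj z - poly p z))\<^sup>2)"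
    by (rule rho2_le[OF dp])
  also have "\<dots> = J * (LINT z:std_triangle|lborel.
      (cmod (cnj (\<kappa> + \<alpha> * z + \<beta> * cnj z) - poly p (\<kappa> + \<alpha> * z + \<beta> * cnj z)))\<^sup>2)"
    by (rule set_integral_eq) (intro borel_measurable_continuous_onI continuous_intros)
  also have "\<dots> = area T * ((cmod (c2 * \<alpha> * \<beta> / 2))\<^sup>2 + Re (c2 * \<alpha> * \<beta> / 2 * cnj (- 2 * c2 * \<alpha> * \<beta>)) / 2
      + ((cmod (- (cnj \<beta> * of_real (D / s))))\<^sup>2 + (cmod (cnj \<alpha> * of_real (D / s)))\<^sup>2) / 4
      + ((cmod (- c2 * \<alpha>\<^sup>2))\<^sup>2 + (cmod (- 2 * c2 * \<alpha> * \<beta>))\<^sup>2 + (cmod (- c2 * \<beta>\<^sup>2))\<^sup>2) / 10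
      + Re (- (cnj \<beta> * of_real (D / s)) * cnj (- c2 * \<beta>\<^sup>2)) / 5
      + Re (- c2 * \<alpha>\<^sup>2 * cnj (cnj \<alpha> * of_real (D / s))) / 5)"
    unfolding h std_triangle_complex_quadratic area_eq by (simp only: mult.assoc)
  also have "\<dots> = area T * (D\<^sup>2 / (4 * s) - D\<^sup>2 * Q * (2 * s\<^sup>2 + x\<^sup>2) / (20 * s ^ 6))"
  proof (rule arg_cong[where f="(*) (area T)"])
    have x2: "x\<^sup>2 = a\<^sup>2 * b\<^sup>2" by (simp add: x_def a_def b_def power_mult_distrib)
    have s_ab: "s = a\<^sup>2 + b\<^sup>2" by (simp add: s_def a_def b_def)
    define C where "C = (cmod c2)\<^sup>2"
    have C: "C = D\<^sup>2 * Q / s ^ 6"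
      by (simp add: C_def c2_def Q_def norm_mult norm_divide norm_power power_mult_distrib power_divide
          power_mult[symmetric] del: complex_cnj_diff)
    have 1: "(cmod (c2 * \<alpha> * \<beta> / 2))\<^sup>2 = C * x\<^sup>2 / 4"
      by (simp add: norm_mult norm_divide power_mult_distrib power_divide C_def x_def)
    have "c2 * \<alpha> * \<beta> / 2 * cnj (- 2 * c2 * \<alpha> * \<beta>) = - of_real ((cmod (c2 * \<alpha> * \<beta>))\<^sup>2)"
      unfolding complex_norm_square by simp
    then have 2: "Re (c2 * \<alpha> * \<beta> / 2 * cnj (- 2 * c2 * \<alpha> * \<beta>)) = - (C * x\<^sup>2)"
      by (simp add: norm_mult power_mult_distrib C_def x_def)
    have 3: "(cmod (- (cnj \<beta> * of_real (D / s))))\<^sup>2 + (cmod (cnj \<alpha> * of_real (D / s)))\<^sup>2 = D\<^sup>2 / s"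
    proof -
      have "(cmod (- (cnj \<beta> * of_real (D / s))))\<^sup>2 + (cmod (cnj \<alpha> * of_real (D / s)))\<^sup>2 = s * (D / s)\<^sup>2"
        by (simp add: norm_mult power_mult_distrib power_divide s_def distrib_right
            add_divide_distrib del: of_real_divide)
      then show ?thesis using s0 by (simp add: power2_eq_square)
    qed
    have 4: "(cmod (- c2 * \<alpha>\<^sup>2))\<^sup>2 + (cmod (- 2 * c2 * \<alpha> * \<beta>))\<^sup>2 + (cmod (- c2 * \<beta>\<^sup>2))\<^sup>2 = C * (s\<^sup>2 + 2 * x\<^sup>2)"
      by (simp add: norm_mult norm_power power_mult_distrib a_def[symmetric] b_def[symmetric] C_def[symmetric] x2 s_ab)
        (simp add: eval_nat_numeral algebra_simps)
    have Re_mult: "Re (of_real t * z) = t * Re z" for t z by simp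
    have "- (cnj \<beta> * of_real (D / s)) * cnj (- c2 * \<beta>\<^sup>2) = of_real (D / s) * cnj (c2 * \<beta> ^ 3)"
      by (simp add: power2_eq_square power3_eq_cube)
    then have "Re (- (cnj \<beta> * of_real (D / s)) * cnj (- c2 * \<beta>\<^sup>2)) = D / s * Re (c2 * \<beta> ^ 3)"
      by (simp only: Re_mult complex_cnj cnj.sel(1))
    moreover have "- c2 * \<alpha>\<^sup>2 * cnj (cnj \<alpha> * of_real (D / s)) = of_real (- (D / s)) * (c2 * \<alpha> ^ 3)"
      by (simp add: power2_eq_square power3_eq_cube)
    then have "Re (- c2 * \<alpha>\<^sup>2 * cnj (cnj \<alpha> * of_real (D / s))) = - (D / s) * Re (c2 * \<alpha> ^ 3)"
      by (simp only: Re_mult)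
    \<comment> \<open>The conjugate in \<open>c2\<close> makes this product real and nonnegative, so
      the two cross terms together lower the value.\<close>
    moreover have "c2 * (\<alpha> ^ 3 - \<beta> ^ 3) = of_real (D / s ^ 3 * Q)"
      by (simp only: c2_def Q_def of_real_mult complex_norm_square mult_ac)
    then have "Re (c2 * \<alpha> ^ 3) - Re (c2 * \<beta> ^ 3) = D / s ^ 3 * Q"
      by (metis Re_complex_of_real minus_complex.sel(1) right_diff_distrib)
    moreover have "D / s * u / 5 + - (D / s) * v / 5 = - (D\<^sup>2 * Q / (5 * s ^ 4))"
      if "v - u = D / s ^ 3 * Q" for u v
    proof -
      have "D / s * u / 5 + - (D / s) * v / 5 = - (D / s / 5) * (v - u)"
        by (simp add: right_diff_distrib diff_divide_distrib)
      then show ?thesis unfolding that by (simp add: eval_nat_numeral)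
    qed
    ultimately have 5: "Re (- (cnj \<beta> * of_real (D / s)) * cnj (- c2 * \<beta>\<^sup>2)) / 5
        + Re (- c2 * \<alpha>\<^sup>2 * cnj (cnj \<alpha> * of_real (D / s))) / 5 = - (D\<^sup>2 * Q / (5 * s ^ 4))"
      by (simp only:)
    show "(cmod (c2 * \<alpha> * \<beta> / 2))\<^sup>2 + Re (c2 * \<alpha> * \<beta> / 2 * cnj (- 2 * c2 * \<alpha> * \<beta>)) / 2
      + ((cmod (- (cnj \<beta> * of_real (D / s))))\<^sup>2 + (cmod (cnj \<alpha> * of_real (D / s)))\<^sup>2) / 4
      + ((cmod (- c2 * \<alpha>\<^sup>2))\<^sup>2 + (cmod (- 2 * c2 * \<alpha> * \<beta>))\<^sup>2 + (cmod (- c2 * \<beta>\<^sup>2))\<^sup>2) / 10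
      + Re (- (cnj \<beta> * of_real (D / s)) * cnj (- c2 * \<beta>\<^sup>2)) / 5
      + Re (- c2 * \<alpha>\<^sup>2 * cnj (cnj \<alpha> * of_real (D / s))) / 5
      = D\<^sup>2 / (4 * s) - D\<^sup>2 * Q * (2 * s\<^sup>2 + x\<^sup>2) / (20 * s ^ 6)"
      \<comment> \<open>The terms quadratic in \<open>c2\<close> add
        \<open>C * (2 * s\<^sup>2 - x\<^sup>2) / 20\<close>; the cross terms subtract
        \<open>C * 4 * s\<^sup>2 / 20\<close>.\<close>
      unfolding add.assoc[of _ "Re (- (cnj \<beta> * of_real (D / s)) * cnj (- c2 * \<beta>\<^sup>2)) / 5"] 1 2 3 4 5 C
      using s0 by (simp add: field_simps eval_nat_numeral)
  qed
  finally show ?thesis by (simp add: D_def)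
qed

lemma rho2_upper_area:
  shows "rho2 T \<le> 3 / 20 * J * area T" and "\<beta> \<noteq> 0 \<Longrightarrow> rho2 T < 3 / 20 * J * area T"
proof -
  have A: "area T > 0" using J_pos by (simp add: area_eq)
  \<comment> \<open>The reverse triangle inequality eliminates the arguments of \<alpha> and
    \<beta>, leaving an inequality between moduli.\<close>
  have "(cmod \<alpha> ^ 3 - cmod \<beta> ^ 3)\<^sup>2 \<le> (cmod (\<alpha> ^ 3 - \<beta> ^ 3))\<^sup>2"
    using norm_triangle_ineq2[of "\<alpha> ^ 3" "\<beta> ^ 3"] det_pos
    by (intro power_mono) (auto simp: norm_power intro: power_mono)
  note key = real_key_inequality[OF norm_ge_zero det_pos this]
  show "rho2 T \<le> 3 / 20 * J * area T"
    using order_trans[OF rho2_upper mult_left_mono[OF key(1) less_imp_le[OF A]]] by (simp add: mult.commute)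
  show "rho2 T < 3 / 20 * J * area T" if "\<beta> \<noteq> 0"
    using le_less_trans[OF rho2_upper mult_strict_left_mono[OF key(2) A]] that by (simp add: mult.commute)
qed

text \<open>For an equilateral triangle only \<open>d2\<close> interacts with the coefficient of
  \<open>cnj z\<close>. Completing the square at \<open>d2 = - cnj \<alpha>\<close> leaves
  \<open>1/4 - 1/10 = 3/20\<close> of \<open>(cmod \<alpha>)\<^sup>2\<close>.\<close>

lemma rho2_lower:
  assumes \<beta>: "\<beta> = 0"
  shows "3 / 20 * J * area T \<le> rho2 T"
  unfolding rho2_def
proof (rule cINF_greatest)
  fix p :: "complex poly" assume "p \<in> {p. degree p \<le> 2}"
  then obtain p0 p1 p2 where p: "p = [:p0, p1, p2:]"
  proof -
    assume *: "p \<in> {p. degree p \<le> 2}" and **: "\<And>p0 p1 p2. p = [:p0, p1, p2:] \<Longrightarrow> thesis"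
    have "p = [:coeff p 0, coeff p 1, coeff p 2:]"
      using * by (auto simp: poly_eq_iff coeff_pCons numeral_2_eq_2 coeff_eq_0 split: nat.split)
    then show thesis by (rule **)
  qed
  define d0 where "d0 = cnj \<kappa> - p0 - p1 * \<kappa> - p2 * \<kappa>\<^sup>2"
  define d1 where "d1 = - p1 * \<alpha> - 2 * p2 * \<kappa> * \<alpha>"
  define d2 where "d2 = - p2 * \<alpha>\<^sup>2"
  have h: "cnj (\<kappa> + \<alpha> * z + \<beta> * cnj z) - poly p (\<kappa> + \<alpha> * z + \<beta> * cnj z)
      = d0 + d1 * z + cnj \<alpha> * cnj z + d2 * z\<^sup>2 + 0 * (z * cnj z) + 0 * (cnj z)\<^sup>2" for z
    by (simp add: p \<beta> d0_def d1_def d2_def power2_eq_square algebra_simps)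
  have "(LINT z:T|lborel. (cmod (cnj z - poly p z))\<^sup>2) = J * (LINT z:std_triangle|lborel.
      (cmod (cnj (\<kappa> + \<alpha> * z + \<beta> * cnj z) - poly p (\<kappa> + \<alpha> * z + \<beta> * cnj z)))\<^sup>2)"
    by (rule set_integral_eq) (intro borel_measurable_continuous_onI continuous_intros)
  also have "\<dots> = area T * ((cmod d0)\<^sup>2 + ((cmod d1)\<^sup>2 + (cmod \<alpha>)\<^sup>2) / 4 + (cmod d2)\<^sup>2 / 10 + Re (d2 * \<alpha>) / 5)"
    unfolding h std_triangle_complex_quadratic area_eq by simp
  also have "\<dots> \<ge> area T * (3 / 20 * J)"
  proof (rule mult_left_mono)
    have "(cmod (d2 + cnj \<alpha>))\<^sup>2 = (cmod d2)\<^sup>2 + 2 * Re (d2 * \<alpha>) + (cmod \<alpha>)\<^sup>2"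
      unfolding cmod_power2 by (simp add: power2_eq_square algebra_simps)
    then have "0 \<le> (cmod d2)\<^sup>2 + 2 * Re (d2 * \<alpha>) + (cmod \<alpha>)\<^sup>2"
      by (metis zero_le_power2)
    moreover have "0 \<le> (cmod d0)\<^sup>2" "0 \<le> (cmod d1)\<^sup>2" by simp_all
    \<comment> \<open>The literal \<open>0\<^sup>2\<close> is the shape of
      \<open>(cmod \<beta>)\<^sup>2\<close> in \<open>J\<close> once \<beta> is replaced by 0, as
      the final matching requires.\<close>
    moreover have "3 / 20 * (C - 0\<^sup>2) \<le> D + (E + C) / 4 + A / 10 + B / 5"
      if "0 \<le> A + 2 * B + C" "0 \<le> D" "0 \<le> E" for A B C D E :: real
      using that by (simp add: add_divide_distrib)
    ultimately show "3 / 20 * J \<le> (cmod d0)\<^sup>2 + ((cmod d1)\<^sup>2 + (cmod \<alpha>)\<^sup>2) / 4 + (cmod d2)\<^sup>2 / 10 + Re (d2 * \<alpha>) / 5"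
      unfolding \<beta> norm_zero by blast
    show "0 \<le> area T" by (simp add: area_def)
  qed
  finally show "3 / 20 * J * area T \<le> (LINT z:T|lborel. (cmod (cnj z - poly p z))\<^sup>2)"
    by (simp add: mult_ac)
qed (auto intro: exI[of _ 0])

end

subsection \<open>Triangles as affine images\<close>

text \<open>The witnesses are the discrete Fourier coefficients of the triple \<open>a\<close>,
  \<open>b\<close>, \<open>c\<close> with respect to the cube roots of unity; \<kappa> is the
  centroid.\<close>

lemma three_points_decomposition:
  fixes a b c :: complex
  obtains \<kappa> \<alpha> \<beta> where "a = \<kappa> + \<alpha> + \<beta>" "b = \<kappa> + \<alpha> * cube_root + \<beta> * cnj cube_root"
    "c = \<kappa> + \<alpha> * cnj cube_root + \<beta> * cube_root"
proof
  let ?\<kappa> = "(a + b + c) / 3" and ?\<alpha> = "(a + b * cnj cube_root + c * cube_root) / 3"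
    and ?\<beta> = "(a + b * cube_root + c * cnj cube_root) / 3"
  show "a = ?\<kappa> + ?\<alpha> + ?\<beta>" "b = ?\<kappa> + ?\<alpha> * cube_root + ?\<beta> * cnj cube_root"
    "c = ?\<kappa> + ?\<alpha> * cnj cube_root + ?\<beta> * cube_root"
    by (simp_all add: complex_eq_iff cube_root_def field_simps sqrt3_mult)
qed

context
  fixes \<kappa> \<alpha> \<beta> a b c :: complex
  assumes abc: "a = \<kappa> + \<alpha> + \<beta>" "b = \<kappa> + \<alpha> * cube_root + \<beta> * cnj cube_root"
    "c = \<kappa> + \<alpha> * cnj cube_root + \<beta> * cube_root"
begin

text \<open>The imaginary part computed below is twice the signed area of the triangle, a nonzero
  multiple of the Jacobian.\<close>

lemma collinear_decomposition_iff: "collinear {a, b, c} \<longleftrightarrow> cmod \<alpha> = cmod \<beta>"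
proof -
  have "collinear {a, b, c} \<longleftrightarrow> collinear {0, b - a, c - a}"
    by (simp add: insert_commute[of a b] collinear_3[of b a c])
  also have "\<dots> \<longleftrightarrow> Im ((c - a) * cnj (b - a)) = 0"
    by (simp add: collinear_iff_Reals complex_is_Real_iff Im_complex_div_eq_0 del: complex_cnj_diff)
  also have "Im ((c - a) * cnj (b - a)) = - (3 * sqrt 3 / 2) * ((cmod \<beta>)\<^sup>2 - (cmod \<alpha>)\<^sup>2)"
    unfolding cmod_power2 abc by (simp add: cube_root_def power2_eq_square field_simps sqrt3_mult)
  also have "\<dots> = 0 \<longleftrightarrow> cmod \<alpha> = cmod \<beta>"
    by auto
  finally show ?thesis .
qed

text \<open>Up to the factor \<open>sqrt 3\<close>, each side length is the distance from \<alpha>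
  to \<beta> times a cube root of unity.\<close>

lemma dist_decomposition:
  "(dist a b)\<^sup>2 = 3 * ((cmod \<alpha>)\<^sup>2 + (cmod \<beta>)\<^sup>2) - 6 * Re (\<alpha> * cnj \<beta> * cube_root)"
  "(dist b c)\<^sup>2 = 3 * ((cmod \<alpha>)\<^sup>2 + (cmod \<beta>)\<^sup>2) - 6 * Re (\<alpha> * cnj \<beta>)"
  "(dist c a)\<^sup>2 = 3 * ((cmod \<alpha>)\<^sup>2 + (cmod \<beta>)\<^sup>2) - 6 * Re (\<alpha> * cnj \<beta> * cnj cube_root)"
proof -
  show "(dist a b)\<^sup>2 = 3 * ((cmod \<alpha>)\<^sup>2 + (cmod \<beta>)\<^sup>2) - 6 * Re (\<alpha> * cnj \<beta> * cube_root)"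
    "(dist b c)\<^sup>2 = 3 * ((cmod \<alpha>)\<^sup>2 + (cmod \<beta>)\<^sup>2) - 6 * Re (\<alpha> * cnj \<beta>)"
    "(dist c a)\<^sup>2 = 3 * ((cmod \<alpha>)\<^sup>2 + (cmod \<beta>)\<^sup>2) - 6 * Re (\<alpha> * cnj \<beta> * cnj cube_root)"
    unfolding dist_norm cmod_power2 abc
    by (simp_all add: cube_root_def power2_eq_square field_simps sqrt3_mult)
qed

text \<open>Equal sides force the products of \<open>?t\<close> with the three cube roots of unity
  to have the same real part. Those real parts sum to 0, so all vanish, and hence
  \<open>?t = 0\<close>.\<close>

lemma equidistant_decomposition:
  assumes "dist a b = d" "dist b c = d" "dist c a = d"
  shows "\<alpha> = 0 \<or> \<beta> = 0" and "d\<^sup>2 = 3 * ((cmod \<alpha>)\<^sup>2 + (cmod \<beta>)\<^sup>2)"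
proof -
  let ?t = "\<alpha> * cnj \<beta>"
  have "x = y" if "d\<^sup>2 = k - 6 * x" "d\<^sup>2 = k - 6 * y" for x y k :: real
    using that by simp
  note cancel = this[OF dist_decomposition(1)[unfolded assms] dist_decomposition(2)[unfolded assms]]
    this[OF dist_decomposition(3)[unfolded assms] dist_decomposition(2)[unfolded assms]]
  have Re_mult: "Re (t * cube_root) = - Re t / 2 - sqrt 3 / 2 * Im t"
    "Re (t * cnj cube_root) = - Re t / 2 + sqrt 3 / 2 * Im t" for t
    by (simp_all add: cube_root_def)
  note cancel[unfolded Re_mult]
  then have "Re ?t = 0" "sqrt 3 / 2 * Im ?t = 0" by argo+
  then have t: "?t = 0" by (simp add: complex_eq_iff)
  then show "\<alpha> = 0 \<or> \<beta> = 0" by simp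
  show "d\<^sup>2 = 3 * ((cmod \<alpha>)\<^sup>2 + (cmod \<beta>)\<^sup>2)"
    using dist_decomposition(2) t unfolding assms by simp
qed

end

lemma is_triangle_imp_affine:
  assumes "is_triangle T"
  obtains \<kappa> \<alpha> \<beta> where "affine_triangle \<kappa> \<alpha> \<beta> T"
proof -
  obtain a b c where nc: "\<not> collinear {a, b, c}" and T: "T = interior (convex hull {a, b, c})"
    using assms by (auto simp: is_triangle_def triangle_with_vertices_def)
  obtain \<kappa> \<alpha> \<beta> where abc: "a = \<kappa> + \<alpha> + \<beta>" "b = \<kappa> + \<alpha> * cube_root + \<beta> * cnj cube_root"
    "c = \<kappa> + \<alpha> * cnj cube_root + \<beta> * cube_root"
    by (rule three_points_decomposition)
  have ne: "cmod \<alpha> \<noteq> cmod \<beta>" using nc collinear_decomposition_iff[OF abc] by simp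
  show ?thesis
  proof (cases "cmod \<beta> < cmod \<alpha>")
    case True
    then show ?thesis using T by (intro that[of \<kappa> \<alpha> \<beta>]) (simp add: affine_triangle_def abc)
  next
    case False
    \<comment> \<open>Exchanging \<alpha> and \<beta> exchanges the vertices \<open>b\<close> and
      \<open>c\<close>, which reverses the orientation and keeps the hull.\<close>
    with ne have "affine_triangle \<kappa> \<beta> \<alpha> T"
      using T by (simp add: affine_triangle_def abc insert_commute add_ac)
    then show ?thesis by (rule that)
  qed
qed

text \<open>The circumradius is the modulus of \<alpha>. Recording its relation to the side
  \<open>d\<close> allows areas to be compared through side lengths.\<close>

lemma equidistant_imp_affine:
  assumes T: "T = interior (convex hull {a, b, c})"
    and d: "dist a b = d" "dist b c = d" "dist c a = d" "d > 0"
  obtains \<kappa> \<alpha> where "affine_triangle \<kappa> \<alpha> 0 T" "d\<^sup>2 = 3 * (cmod \<alpha>)\<^sup>2"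
proof -
  obtain \<kappa> \<alpha> \<beta> where abc: "a = \<kappa> + \<alpha> + \<beta>" "b = \<kappa> + \<alpha> * cube_root + \<beta> * cnj cube_root"
    "c = \<kappa> + \<alpha> * cnj cube_root + \<beta> * cube_root"
    by (rule three_points_decomposition)
  note e = equidistant_decomposition[OF abc d(1-3)]
  show ?thesis
  proof (cases "\<beta> = 0")
    case True
    with e d have "\<alpha> \<noteq> 0" by auto
    then show ?thesis using True T e
      by (intro that[of \<kappa> \<alpha>]) (simp_all add: affine_triangle_def abc)
  next
    case False
    with e have "\<alpha> = 0" by simp
    then show ?thesis using False T e
      by (intro that[of \<kappa> \<beta>]) (simp_all add: affine_triangle_def abc insert_commute)
  qed
qed

section \<open>Equilateral triangles and congruence\<close>

lemma affine_imp_is_equilateral: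
  assumes "affine_triangle \<kappa> \<alpha> 0 T"
  shows "is_equilateral T"
proof -
  interpret affine_triangle \<kappa> \<alpha> 0 T by fact
  let ?a = "\<kappa> + \<alpha>" and ?b = "\<kappa> + \<alpha> * cube_root" and ?c = "\<kappa> + \<alpha> * cnj cube_root"
  have abc: "?a = \<kappa> + \<alpha> + 0" "?b = \<kappa> + \<alpha> * cube_root + 0 * cnj cube_root"
    "?c = \<kappa> + \<alpha> * cnj cube_root + 0 * cube_root" by simp_all
  have "triangle_with_vertices ?a ?b ?c T"
    using collinear_decomposition_iff[OF abc] T_eq det_pos by (simp add: triangle_with_vertices_def)
  moreover have "(dist ?a ?b)\<^sup>2 = (dist ?b ?c)\<^sup>2" "(dist ?b ?c)\<^sup>2 = (dist ?c ?a)\<^sup>2"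
    unfolding dist_decomposition[OF abc] by simp_all
  ultimately show ?thesis
    unfolding is_equilateral_def by (metis power2_eq_imp_eq zero_le_dist)
qed

lemma is_equilateral_imp_affine:
  assumes "is_equilateral T"
  obtains \<kappa> \<alpha> where "affine_triangle \<kappa> \<alpha> 0 T"
proof -
  obtain a b c where t: "\<not> collinear {a, b, c}" "T = interior (convex hull {a, b, c})"
    and d: "dist a b = dist b c" "dist b c = dist c a"
    using assms by (auto simp: is_equilateral_def triangle_with_vertices_def)
  have "a \<noteq> b" using t by (auto simp: collinear_2)
  then have "dist a b > 0" by simp
  then show ?thesis
    using equidistant_imp_affine[OF t(2), of "dist a b"] d that by metis
qed

lemma is_equilateral_imp_is_triangle: "is_equilateral T \<Longrightarrow> is_triangle T"
  by (auto simp: is_equilateral_def is_triangle_def)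

text \<open>After subtracting its value at 0, an isometry is an orthogonal transformation.
  Translations and injective linear maps commute with both hull and interior.\<close>

lemma isometry_image_interior_hull:
  fixes f :: "complex \<Rightarrow> complex"
  assumes f: "\<And>x y. dist (f x) (f y) = dist x y"
  shows "f ` interior (convex hull S) = interior (convex hull (f ` S))"
proof -
  define h where "h = (\<lambda>x. f x - f 0)"
  have orth: "orthogonal_transformation h"
    unfolding orthogonal_transformation_isometry using f by (simp add: h_def dist_norm)
  then have lin: "linear h" and inj: "inj h"
    by (auto simp: orthogonal_transformation_linear orthogonal_transformation_inj)
  have *: "f ` X = (+) (f 0) ` h ` X" for X
    by (simp add: h_def image_image)
  show ?thesis
    unfolding * convex_hull_translation interior_translation
      convex_hull_linear_image[OF lin, symmetric] interior_injective_linear_image[OF lin inj] ..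
qed

text \<open>Equal areas force equal circumradii, so a rotation about the centre followed by a
  translation carries vertices to vertices.\<close>

lemma equilateral_congruent:
  assumes E: "affine_triangle \<kappa> \<alpha> 0 E" and T: "affine_triangle \<kappa>' \<alpha>' 0 T" and "area E = area T"
  shows "congruent_sets E T"
proof -
  interpret E: affine_triangle \<kappa> \<alpha> 0 E by fact
  interpret T: affine_triangle \<kappa>' \<alpha>' 0 T by fact
  have eq: "cmod \<alpha>' = cmod \<alpha>"
    using assms(3) unfolding E.area_eq T.area_eq by simp
  have \<alpha>0: "\<alpha> \<noteq> 0" using E.det_pos by auto
  define f where "f z = \<kappa>' + \<alpha>' / \<alpha> * (z - \<kappa>)" for z
  have f: "dist (f x) (f y) = dist x y" for x y
  proof -
    have "f x - f y = \<alpha>' / \<alpha> * (x - y)" by (simp add: f_def right_diff_distrib)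
    then show ?thesis using \<alpha>0 eq by (simp add: dist_norm norm_mult norm_divide)
  qed
  have "f ` E = T"
    unfolding E.T_eq T.T_eq isometry_image_interior_hull[OF f] using \<alpha>0 by (simp add: f_def)
  with f show ?thesis unfolding congruent_sets_def by blast
qed

text \<open>Since the isometry may be a reflection, the image is recognized by its three side
  lengths, which also fix its area.\<close>

lemma congruent_equilateral:
  assumes E: "affine_triangle \<kappa> \<alpha> 0 E" and "congruent_sets E T"
  obtains \<kappa>' \<alpha>' where "affine_triangle \<kappa>' \<alpha>' 0 T" "area T = area E"
proof -
  interpret E: affine_triangle \<kappa> \<alpha> 0 E by fact
  obtain f where f: "\<And>x y. dist (f x) (f y) = dist x y" and fE: "f ` E = T"
    using assms(2) unfolding congruent_sets_def by blast
  let ?a = "\<kappa> + \<alpha>" and ?b = "\<kappa> + \<alpha> * cube_root" and ?c = "\<kappa> + \<alpha> * cnj cube_root"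
  have abc: "?a = \<kappa> + \<alpha> + 0" "?b = \<kappa> + \<alpha> * cube_root + 0 * cnj cube_root"
    "?c = \<kappa> + \<alpha> * cnj cube_root + 0 * cube_root" by simp_all
  define d where "d = sqrt (3 * (cmod \<alpha>)\<^sup>2)"
  have d2: "d\<^sup>2 = 3 * (cmod \<alpha>)\<^sup>2" by (simp add: d_def)
  have "d > 0" using E.det_pos by (simp add: d_def)
  have "(dist ?a ?b)\<^sup>2 = d\<^sup>2" "(dist ?b ?c)\<^sup>2 = d\<^sup>2" "(dist ?c ?a)\<^sup>2 = d\<^sup>2"
    unfolding dist_decomposition[OF abc] d2 by simp_all
  then have d: "dist ?a ?b = d" "dist ?b ?c = d" "dist ?c ?a = d"
    using \<open>d > 0\<close> by (auto intro: power2_eq_imp_eq)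
  have T: "T = interior (convex hull {f ?a, f ?b, f ?c})"
    unfolding fE[symmetric] E.T_eq isometry_image_interior_hull[OF f] by simp
  obtain \<kappa>' \<alpha>' where T': "affine_triangle \<kappa>' \<alpha>' 0 T" "d\<^sup>2 = 3 * (cmod \<alpha>')\<^sup>2"
    using equidistant_imp_affine[OF T] d \<open>d > 0\<close> by (metis f)
  interpret T: affine_triangle \<kappa>' \<alpha>' 0 T by (rule T')
  have "area T = area E"
    unfolding T.area_eq E.area_eq using T'(2) d2 by simp
  with T'(1) show ?thesis by (rule that)
qed

section \<open>Extremality at fixed area\<close>

theorem corollary2p11:
  fixes A :: real
  assumes "A > 0"
  shows "(\<exists>E. is_equilateral E \<and> area E = A) \<and>
    (\<forall>E. is_equilateral E \<and> area E = A \<longrightarrow>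
      (\<forall>T. is_arg_max rho2 (\<lambda>T. is_triangle T \<and> area T = A) T \<longleftrightarrow> congruent_sets E T))"
proof (intro conjI allI impI)
  \<comment> \<open>The circumradius of the equilateral triangle of area \<open>A\<close>.\<close>
  define r where "r = sqrt (A / (3 * sqrt 3 / 4))"
  have r: "r > 0" "r\<^sup>2 = A / (3 * sqrt 3 / 4)" using assms by (simp_all add: r_def)
  define E where "E = interior (convex hull {0 + complex_of_real r + 0,
    0 + complex_of_real r * cube_root + 0 * cnj cube_root, 0 + complex_of_real r * cnj cube_root + 0 * cube_root})"
  interpret E: affine_triangle 0 "complex_of_real r" 0 E
    by (rule affine_triangle.intro[OF _ E_def]) (use r in simp)
  have "is_equilateral E" by (rule affine_imp_is_equilateral) (rule E.affine_triangle_axioms)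
  moreover have "area E = A" using r unfolding E.area_eq by simp
  ultimately show "\<exists>E. is_equilateral E \<and> area E = A" by blast
next
  \<comment> \<open>The extremal value: fixing the area fixes the Jacobian, so the bound
    \<open>3 / 20 * J * area T\<close> is the same for all competitors.\<close>
  define M where "M = 3 / 20 * (A / (3 * sqrt 3 / 4)) * A"
  fix E T :: "complex set"
  assume *: "is_equilateral E \<and> area E = A"
  obtain \<kappa> \<alpha> where E: "affine_triangle \<kappa> \<alpha> 0 E"
    using * is_equilateral_imp_affine by blast
  have J: "(cmod \<alpha>')\<^sup>2 - (cmod \<beta>')\<^sup>2 = A / (3 * sqrt 3 / 4)"
    if "affine_triangle \<kappa>' \<alpha>' \<beta>' X" "area X = A" for \<kappa>' \<alpha>' \<beta>' X
    using affine_triangle.area_eq[OF that(1)] that(2) by (simp add: field_simps)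
  have upper: "rho2 X \<le> M" if X: "is_triangle X" "area X = A" for X
  proof -
    obtain \<kappa>' \<alpha>' \<beta>' where X': "affine_triangle \<kappa>' \<alpha>' \<beta>' X"
      using X is_triangle_imp_affine by blast
    show ?thesis
      using affine_triangle.rho2_upper_area(1)[OF X'] unfolding J[OF X' X(2)] X(2) M_def .
  qed
  have lower: "M \<le> rho2 X" if X: "affine_triangle \<kappa>' \<alpha>' 0 X" "area X = A" for \<kappa>' \<alpha>' X
    using affine_triangle.rho2_lower[OF X(1) refl] unfolding J[OF X] X(2) M_def .
  show "is_arg_max rho2 (\<lambda>T. is_triangle T \<and> area T = A) T \<longleftrightarrow> congruent_sets E T"
  proof
    assume max: "is_arg_max rho2 (\<lambda>T. is_triangle T \<and> area T = A) T"
    then have T: "is_triangle T" "area T = A" by (auto simp: is_arg_max_def)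
    obtain \<kappa>' \<alpha>' \<beta>' where T': "affine_triangle \<kappa>' \<alpha>' \<beta>' T"
      using T is_triangle_imp_affine by blast
    \<comment> \<open>Comparing with \<open>E\<close> alone is enough: \<open>rho2 E\<close> is at
      least \<open>M\<close>, whereas a nonzero \<open>\<beta>'\<close> would put
      \<open>rho2 T\<close> strictly below \<open>M\<close>.\<close>
    have "\<not> rho2 T < rho2 E"
      using max * is_equilateral_imp_is_triangle by (auto simp: is_arg_max_def)
    then have "\<not> rho2 T < M"
      using lower[OF E] * by simp
    then have "\<beta>' = 0"
      using affine_triangle.rho2_upper_area(2)[OF T'] unfolding J[OF T' T(2)] T(2) M_def by blast
    then show "congruent_sets E T"
      using equilateral_congruent[OF E] T' T(2) * by simp
  next
    assume "congruent_sets E T"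
    then obtain \<kappa>' \<alpha>' where T': "affine_triangle \<kappa>' \<alpha>' 0 T" "area T = A"
      using congruent_equilateral[OF E] * by metis
    then have "is_triangle T"
      using affine_imp_is_equilateral is_equilateral_imp_is_triangle by blast
    with T' lower[OF T'] upper show "is_arg_max rho2 (\<lambda>T. is_triangle T \<and> area T = A) T"
      by (fastforce simp: is_arg_max_def)
  qed
qed

end
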